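(* Let $\mathcal{R}$ be the Ricci curvature of $\Sigma$, considered as a map $T\Sigma\to T\Sigma$. For any $X=X^be_b\in T\Sigma$ it holds that $$\mathcal{R}(X)=g^{qd}g^{ac}\,\bar g\big(\bar R(e_c,e_d)e_b,e_a\big)X^be_q+\frac{1}{\gamma^4}\sum_{A=1}^p\Big[(\operatorname{Tr}\mathcal{B}_A)\,\mathcal{B}_A(X)-\mathcal{B}_A^2(X)\Big],$$ where $\bar R$ is the curvature tensor of $M$ and $\mathcal{B}_A^2=\mathcal{B}_A\circ\mathcal{B}_A$.
   Context: Setting: $n\ge 2$, $p\ge1$, $\Sigma$ is an $n$-dimensional manifold embedded in a Riemannian manifold $(M,\bar g)$ with $\dim M=m=n+p$. $x^1,\dots,x^m$ are local coordinates on $M$, $u^1,\dots,u^n$ local coordinates on $\Sigma$; the $x^i$ are regarded as functions of the $u^a$ (the embedding), and $\partial_a=\partial/\partial u^a$. Repeated indices are summed ($i,j,k,l$ from $1$ to $m$; $a,b,c,d,q$ from $1$ to $n$). $e_a=(\partial_ax^i)\partial_i$ is the basis of $T\Sigma\subset TM$, $g_{ab}=\bar g(e_a,e_b)$, $g=\det(g_{ab})$, $(g^{ab})$ is the inverse of $(g_{ab})$. $N_A=n_A^i\partial_i$, $A=1,\dots,p$, are (local, smooth) normal vector fields along $\Sigma$ with $\bar g(N_A,N_B)=\delta_{AB}$, $\bar g(N_A,e_a)=0$. $\bar\nabla$ is the Levi-Civita connection of $M$ with Christoffel symbols $\bar\Gamma^i_{jk}$, and $(\bar\nabla_aN_A)^i=\partial_an_A^i+\bar\Gamma^i_{jk}(\partial_ax^j)n_A^k$.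 $TM$ refers to tangent vectors of $M$ at points of $\Sigma$. Curvature convention: $R(X,Y)Z=\nabla_X\nabla_YZ-\nabla_Y\nabla_XZ-\nabla_{[X,Y]}Z$ (likewise for $\bar R$), and the Ricci map is $\mathcal{R}^q_b=g^{ac}g^{qd}g(R(e_c,e_d)e_b,e_a)$, where $R$ is the curvature of $\Sigma$ with its induced metric. $\rho$ is an arbitrary non-vanishing density on $\Sigma$, $\{f_1,\dots,f_n\}=\frac1\rho\varepsilon^{a_1\cdots a_n}(\partial_{a_1}f_1)\cdots(\partial_{a_n}f_n)$ with $\varepsilon$ the Levi-Civita symbol ($\varepsilon^{12\cdots n}=1$), and $\gamma=\sqrt g/\rho$. For multi-indices $J=j_1\cdots j_{n-1}$, $\vec a=a_1\cdots a_{n-1}$: $\{f,\vec x^J\}=\{f,x^{j_1},\dots,x^{j_{n-1}}\}$, $\partial_{\vec a}\vec x^I=(\partial_{a_1}x^{i_1})\cdots(\partial_{a_{n-1}}x^{i_{n-1}})$, $\bar g_{IJ}=\bar g_{i_1j_1}\cdots\bar g_{i_{n-1}j_{n-1}}$. Define $$\mathcal{P}^{iJ}=\tfrac{1}{\sqrt{(n-1)!}}\{x^i,\vec x^J\},\quad \mathcal{T}_A^{Ij}=\tfrac{(-1)^n}{\sqrt{(n-1)!}}\tfrac{\varepsilon^{\vec a a}}{\rho}(\partial_{\vec a}\vec x^I)(\bar\nabla_aN_A)^j,\quad (\mathcal{B}_A)^{ik}=\mathcal{P}^{iI}(\mathcal{T}_A)^{Jk}\bar g_{IJ}.$$ $\mathcal{B}_A$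 is viewed as a map $TM\to TM$ by lowering the second index with $\bar g$: $\mathcal{B}_A(X)^i=(\mathcal{B}_A)^{ik}\bar g_{kj}X^j$. $\operatorname{Tr}\mathcal{B}=\mathcal{B}^i_i$. *)

theory Defs
  imports "HOL-Analysis.Analysis" "HOL-Combinatorics.Permutations"
begin

section \<open>Smoothness on open subsets of Euclidean space\<close>

primrec higher_diff_on ::
  "'a::euclidean_space set \<Rightarrow> ('a \<Rightarrow> 'b::real_normed_vector) \<Rightarrow> nat \<Rightarrow> bool" where
  "higher_diff_on U f 0 \<longleftrightarrow> continuous_on U f"
| "higher_diff_on U f (Suc k) \<longleftrightarrow>
     (\<forall>u\<in>U. f differentiable (at u)) \<and>
     (\<forall>v. higher_diff_on U (\<lambda>u. frechet_derivative f (at u) v) k)"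

text \<open>Only meant for open \<open>U\<close>: the derivatives are taken in the ambient space.\<close>

definition smooth_on :: "'a::euclidean_space set \<Rightarrow> ('a \<Rightarrow> 'b::real_normed_vector) \<Rightarrow> bool" where
  "smooth_on U f \<longleftrightarrow> (\<forall>k. higher_diff_on U f k)"

definition partial :: "'k::finite \<Rightarrow> (real^'k \<Rightarrow> 'b::real_normed_vector) \<Rightarrow> real^'k \<Rightarrow> 'b" where
  "partial a f u = frechet_derivative f (at u) (axis a 1)"


section \<open>Riemannian manifolds and embedded submanifolds\<close>

text \<open>A chart is a pair of its domain and its coordinate map; the dimension of a manifold is the
  cardinality of the index type of its coordinates.\<close>

type_synonym ('a, 'k) chart = "'a set \<times> ('a \<Rightarrow> real^'k)"

definition is_chart :: "'a topology \<Rightarrow> ('a, 'k::finite) chart \<Rightarrow> bool" where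
  "is_chart M c \<longleftrightarrow> openin M (fst c) \<and> open (snd c ` fst c) \<and>
     homeomorphic_map (subtopology M (fst c)) (top_of_set (snd c ` fst c)) (snd c)"

text \<open>The coordinates of the second chart as functions of those of the first one, on the
  part of coordinate space corresponding to the overlap. The two charts may have different
  dimensions, so that this also expresses an inclusion in local coordinates.\<close>

definition overlap :: "('a, 'k::finite) chart \<Rightarrow> ('a, 'l::finite) chart \<Rightarrow> (real^'k) set" where
  "overlap c c' = snd c ` (fst c \<inter> fst c')"

definition coord_change ::
  "('a, 'k::finite) chart \<Rightarrow> ('a, 'l::finite) chart \<Rightarrow> real^'k \<Rightarrow> real^'l" where
  "coord_change c c' = snd c' \<circ> inv_into (fst c) (snd c)"

definition smooth_manifold :: "'a topology \<Rightarrow> ('a, 'k::finite) chart set \<Rightarrow> bool" where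
  "smooth_manifold M \<A> \<longleftrightarrow>
     Hausdorff_space M \<and> second_countable M \<and>
     (\<forall>c\<in>\<A>. is_chart M c) \<and> (\<Union>c\<in>\<A>. fst c) = topspace M \<and>
     (\<forall>c\<in>\<A>. \<forall>c'\<in>\<A>. smooth_on (overlap c c') (coord_change c c'))"

text \<open>A Riemannian metric is given by its matrix of components in every chart of the atlas; the
  last condition is the transformation law of a covariant 2-tensor.\<close>

definition riemannian_metric ::
  "('a, 'k::finite) chart set \<Rightarrow> (('a, 'k) chart \<Rightarrow> real^'k \<Rightarrow> real^'k^'k) \<Rightarrow> bool" where
  "riemannian_metric \<A> gbar \<longleftrightarrow>
     (\<forall>c\<in>\<A>. smooth_on (snd c ` fst c) (gbar c) \<and>
        (\<forall>y \<in> snd c ` fst c. transpose (gbar c y) = gbar c y \<and>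
           (\<forall>v. v \<noteq> 0 \<longrightarrow> v \<bullet> (gbar c y *v v) > 0))) \<and>
     (\<forall>c\<in>\<A>. \<forall>c'\<in>\<A>. \<forall>y \<in> overlap c c'.
        let J = matrix (frechet_derivative (coord_change c c') (at y))
        in gbar c y = transpose J ** gbar c' (coord_change c c' y) ** J)"

definition embedded_submanifold ::
  "'a topology \<Rightarrow> ('a, 'm::finite) chart set \<Rightarrow> 'a set \<Rightarrow> ('a, 'n::finite) chart set \<Rightarrow> bool" where
  "embedded_submanifold M \<A> S \<B> \<longleftrightarrow>
     S \<subseteq> topspace M \<and> smooth_manifold (subtopology M S) \<B> \<and>
     (\<forall>c\<in>\<B>. \<forall>c'\<in>\<A>. smooth_on (overlap c c') (coord_change c c') \<and>
        (\<forall>u \<in> overlap c c'. inj (frechet_derivative (coord_change c c') (at u))))"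


section \<open>Levi-Civita connection and curvature in local coordinates\<close>

definition metric_prod :: "real^'k^'k \<Rightarrow> real^'k::finite \<Rightarrow> real^'k \<Rightarrow> real" where
  "metric_prod G v w = (\<Sum>i\<in>UNIV. \<Sum>j\<in>UNIV. G $ i $ j * v $ i * w $ j)"

definition christoffel ::
  "(real^'k \<Rightarrow> real^'k^'k) \<Rightarrow> real^'k::finite \<Rightarrow> 'k \<Rightarrow> 'k \<Rightarrow> 'k \<Rightarrow> real" where
  "christoffel G y i j k = 1/2 * (\<Sum>l\<in>UNIV. matrix_inv (G y) $ i $ l *
     (partial j (\<lambda>z. G z $ l $ k) y + partial k (\<lambda>z. G z $ l $ j) y
      - partial l (\<lambda>z. G z $ j $ k) y))"

definition cov_deriv ::
  "(real^'k \<Rightarrow> real^'k^'k) \<Rightarrow> (real^'k \<Rightarrow> real^'k) \<Rightarrow> (real^'k \<Rightarrow> real^'k) \<Rightarrow> real^'k::finite \<Rightarrow> real^'k"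
  where
  "cov_deriv G X Y y = (\<chi> i. (\<Sum>j\<in>UNIV. X y $ j * partial j (\<lambda>z. Y z $ i) y)
     + (\<Sum>j\<in>UNIV. \<Sum>k\<in>UNIV. christoffel G y i j k * X y $ j * Y y $ k))"

definition lie_bracket ::
  "(real^'k \<Rightarrow> real^'k) \<Rightarrow> (real^'k \<Rightarrow> real^'k) \<Rightarrow> real^'k::finite \<Rightarrow> real^'k" where
  "lie_bracket X Y y = (\<chi> i. \<Sum>j\<in>UNIV.
     X y $ j * partial j (\<lambda>z. Y z $ i) y - Y y $ j * partial j (\<lambda>z. X z $ i) y)"

definition curvature ::
  "(real^'k \<Rightarrow> real^'k^'k) \<Rightarrow> (real^'k \<Rightarrow> real^'k) \<Rightarrow> (real^'k \<Rightarrow> real^'k) \<Rightarrow> (real^'k \<Rightarrow> real^'k) \<Rightarrow>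
   real^'k::finite \<Rightarrow> real^'k" where
  "curvature G X Y Z y =
     cov_deriv G X (cov_deriv G Y Z) y - cov_deriv G Y (cov_deriv G X Z) y
     - cov_deriv G (lie_bracket X Y) Z y"

text \<open>The value of the curvature tensor on tangent vectors at a point. By tensoriality it does not
  depend on how the vectors are extended to vector fields; the extensions used here have constant
  components in the given coordinates.\<close>

definition curvature_at ::
  "(real^'k \<Rightarrow> real^'k^'k) \<Rightarrow> real^'k::finite \<Rightarrow> real^'k \<Rightarrow> real^'k \<Rightarrow> real^'k \<Rightarrow> real^'k" where
  "curvature_at G y v w z = curvature G (\<lambda>_. v) (\<lambda>_. w) (\<lambda>_. z) y"

text \<open>The Ricci map, with \<open>matrix_inv (G u)\<close> in the role of \<open>(g\<^sup>a\<^sup>b)\<close> and row index \<open>q\<close>,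
  column index \<open>b\<close>.\<close>

definition ricci_map :: "(real^'k \<Rightarrow> real^'k^'k) \<Rightarrow> real^'k::finite \<Rightarrow> real^'k^'k" where
  "ricci_map G u = (\<chi> q b. \<Sum>a\<in>UNIV. \<Sum>c\<in>UNIV. \<Sum>d\<in>UNIV.
     matrix_inv (G u) $ a $ c * matrix_inv (G u) $ q $ d *
     metric_prod (G u) (curvature_at G u (axis c 1) (axis d 1) (axis b 1)) (axis a 1))"


section \<open>Geometry of a submanifold in local coordinates\<close>

text \<open>Throughout, \<open>x\<close> gives the coordinates of \<open>M\<close> as functions of those of \<open>\<Sigma>\<close>, \<open>h\<close> is the
  component matrix of the metric of \<open>M\<close>, and \<open>N\<close> is a vector field along \<open>\<Sigma>\<close>, that is, its
  components with respect to the coordinates of \<open>M\<close> as functions of those of \<open>\<Sigma>\<close>.\<close>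

definition tangent_basis ::
  "(real^'n \<Rightarrow> real^'m) \<Rightarrow> 'n::finite \<Rightarrow> real^'n \<Rightarrow> real^'m::finite" where
  "tangent_basis x a u = (\<chi> i. partial a (\<lambda>v. x v $ i) u)"

definition induced_metric ::
  "(real^'m \<Rightarrow> real^'m^'m) \<Rightarrow> (real^'n \<Rightarrow> real^'m::finite) \<Rightarrow> real^'n::finite \<Rightarrow> real^'n^'n" where
  "induced_metric h x u =
     (\<chi> a b. metric_prod (h (x u)) (tangent_basis x a u) (tangent_basis x b u))"

definition cov_deriv_along ::
  "(real^'m \<Rightarrow> real^'m^'m) \<Rightarrow> (real^'n \<Rightarrow> real^'m) \<Rightarrow> 'n::finite \<Rightarrow> (real^'n \<Rightarrow> real^'m) \<Rightarrow>
   real^'n \<Rightarrow> real^'m::finite" where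
  "cov_deriv_along h x a N u = (\<chi> i. partial a (\<lambda>v. N v $ i) u
     + (\<Sum>j\<in>UNIV. \<Sum>k\<in>UNIV. christoffel h (x u) i j k * partial a (\<lambda>v. x v $ j) u * N u $ k))"


section \<open>Multi-linear brackets and the maps built from them\<close>

text \<open>Multi-indices are lists. The linear order on the index type identifies it with
  \<open>1, \<dots>, n\<close>: the element \<open>a\<close> has position \<open>card {b. b < a}\<close>, counted from \<open>0\<close>.\<close>

definition multi_indices :: "nat \<Rightarrow> 'k list set" where
  "multi_indices r = {J. length J = r}"

definition levi_civita :: "'n::{finite,linorder} list \<Rightarrow> real" where
  "levi_civita as = (if length as = CARD('n) \<and> distinct as
     then of_int (sign (\<lambda>a::'n. as ! card {b. b < a})) else 0)"

definition nbracket ::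
  "(real^'n::_ \<Rightarrow> real) \<Rightarrow> (real^'n::_ \<Rightarrow> real) list \<Rightarrow> real^'n::{finite,linorder} \<Rightarrow> real" where
  "nbracket \<rho> fs u = 1 / \<rho> u * (\<Sum>as \<in> multi_indices CARD('n).
     levi_civita as * (\<Prod>k<CARD('n). partial (as ! k) (fs ! k) u))"

definition P_tensor ::
  "(real^'n::_ \<Rightarrow> real) \<Rightarrow> (real^'n::_ \<Rightarrow> real^'m::finite) \<Rightarrow> real^'n::{finite,linorder} \<Rightarrow>
   'm \<Rightarrow> 'm list \<Rightarrow> real" where
  "P_tensor \<rho> x u i J = 1 / sqrt (fact (CARD('n) - 1)) *
     nbracket \<rho> ((\<lambda>v. x v $ i) # map (\<lambda>j v. x v $ j) J) u"

definition T_tensor ::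
  "(real^'m \<Rightarrow> real^'m^'m) \<Rightarrow> (real^'n::_ \<Rightarrow> real) \<Rightarrow> (real^'n::_ \<Rightarrow> real^'m::finite) \<Rightarrow>
   (real^'n::_ \<Rightarrow> real^'m) \<Rightarrow> real^'n::{finite,linorder} \<Rightarrow> 'm list \<Rightarrow> 'm \<Rightarrow> real" where
  "T_tensor h \<rho> x N u I j = (-1) ^ CARD('n) / sqrt (fact (CARD('n) - 1)) *
     (\<Sum>as \<in> multi_indices (CARD('n) - 1). \<Sum>a\<in>UNIV.
        levi_civita (as @ [a]) / \<rho> u *
        (\<Prod>k<CARD('n) - 1. partial (as ! k) (\<lambda>v. x v $ (I ! k)) u) *
        cov_deriv_along h x a N u $ j)"

definition B_tensor ::
  "(real^'m \<Rightarrow> real^'m^'m) \<Rightarrow> (real^'n::_ \<Rightarrow> real) \<Rightarrow> (real^'n::_ \<Rightarrow> real^'m::finite) \<Rightarrow>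
   (real^'n::_ \<Rightarrow> real^'m) \<Rightarrow> real^'n::{finite,linorder} \<Rightarrow> real^'m^'m" where
  "B_tensor h \<rho> x N u = (\<chi> i k.
     \<Sum>I \<in> multi_indices (CARD('n) - 1). \<Sum>J \<in> multi_indices (CARD('n) - 1).
       P_tensor \<rho> x u i I * T_tensor h \<rho> x N u J k *
       (\<Prod>r<CARD('n) - 1. h (x u) $ (I ! r) $ (J ! r)))"

text \<open>The matrix of \<open>\<B>\<close> as an endomorphism of the tangent space of \<open>M\<close>, obtained by lowering the
  second index.\<close>

definition B_map ::
  "(real^'m \<Rightarrow> real^'m^'m) \<Rightarrow> (real^'n::_ \<Rightarrow> real) \<Rightarrow> (real^'n::_ \<Rightarrow> real^'m::finite) \<Rightarrow>
   (real^'n::_ \<Rightarrow> real^'m) \<Rightarrow> real^'n::{finite,linorder} \<Rightarrow> real^'m^'m" where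
  "B_map h \<rho> x N u = B_tensor h \<rho> x N u ** h (x u)"

definition density_ratio ::
  "(real^'m \<Rightarrow> real^'m^'m) \<Rightarrow> (real^'n \<Rightarrow> real) \<Rightarrow> (real^'n \<Rightarrow> real^'m::finite) \<Rightarrow>
   real^'n::finite \<Rightarrow> real" where
  "density_ratio h \<rho> x u = sqrt (det (induced_metric h x u)) / \<rho> u"

end

theory Submission
  imports Defs
begin

text \<open>
  The formula is the contracted Gauss equation, once \<open>\<B>\<^sub>A\<close> is recognized as a multiple of the shape
  operator. Write \<open>K\<^sub>A\<close> for the second fundamental form of the normal field \<open>N\<^sub>A\<close>, that is
  \<open>K\<^sub>A(a,b) = gbar(D\<^sub>a e\<^sub>b, N\<^sub>A)\<close> with \<open>D\<close> the covariant derivative along \<open>\<Sigma>\<close>, and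
  \<open>S\<^sub>A = g\<^sup>-\<^sup>1 K\<^sub>A\<close> for the shape operator.

  Algebraic half. The product \<open>\<P> \<T>\<close> contracts two Levi-Civita symbols, each with one free index,
  against \<open>n - 1\<close> factors \<open>gbar(e\<^sub>a, e\<^sub>b) = g\<^sub>a\<^sub>b\<close>. This is the cofactor expansion of a determinant,
  and it produces \<open>(n - 1)! det g\<close> times the inverse matrix of \<open>g\<close> (\<open>levi_civita_cofactor\<close>). Moving
  the free index of the second symbol from last to first place costs \<open>(-1)\<^sup>n\<^sup>-\<^sup>1\<close>, which together with
  the sign \<open>(-1)\<^sup>n\<close> in \<open>\<T>\<close> leaves a minus; the Weingarten equation \<open>gbar(D\<^sub>b N\<^sub>A, e\<^sub>c) = - K\<^sub>A(b,c)\<close>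
  provides another. So \<open>\<B>\<^sub>A\<close> acts on \<open>T\<Sigma>\<close> as \<open>\<kappa> S\<^sub>A\<close> with \<open>\<kappa> = det g / \<rho>\<^sup>2\<close>, and its trace over
  \<open>TM\<close> is \<open>\<kappa> tr S\<^sub>A\<close> (\<open>B_map_shape_operator\<close>). As \<open>\<gamma>\<^sup>4 = \<kappa>\<^sup>2\<close>, the density cancels.

  Geometric half. It remains to see that the Ricci map is the contraction of the ambient curvature plus
  \<open>\<Sum>\<^sub>A ((tr S\<^sub>A) S\<^sub>A - S\<^sub>A\<^sup>2)\<close>, which follows from the Gauss equation (\<open>gauss_equation\<close>). The latter
  rests on one identity, valid for any smooth map \<open>x\<close> into a Riemannian coordinate domain
  (\<open>curvature_frame\<close>): the component \<open>gbar(R(e\<^sub>c, e\<^sub>d)e\<^sub>b, e\<^sub>a)\<close> is the antisymmetrization in \<open>c, d\<close> of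
  \<open>\<partial>\<^sub>c gbar(D\<^sub>d e\<^sub>b, e\<^sub>a) - gbar(D\<^sub>d e\<^sub>b, D\<^sub>c e\<^sub>a)\<close>. Here \<open>gbar(D\<^sub>d e\<^sub>b, e\<^sub>a)\<close> is given by the Koszul
  formula in terms of the induced metric only (\<open>koszul_frame\<close>). The identity is used twice, for the
  embedding of \<open>\<Sigma>\<close> and for the identity map of the coordinate domain of \<open>\<Sigma>\<close> with the metric \<open>g\<close>. The
  derivative terms agree, the tangential parts of the quadratic terms agree as well, and the
  difference of the two curvatures consists of the normal parts of the quadratic terms, namely
  products of entries of the \<open>K\<^sub>A\<close>. The splitting into tangential and normal part uses that the \<open>e\<^sub>a\<close>
  and \<open>N\<^sub>A\<close> span, which is a matter of dimension.
\<close>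

section \<open>Levi-Civita symbols and determinants\<close>

text \<open>The list \<open>as\<close> is a word in the letters \<open>'n\<close>, and a letter has a position in the alphabet; reading
  the word at that position turns the words without repetition into the permutations of the alphabet.\<close>

definition position :: "'n::{finite,linorder} \<Rightarrow> nat" where
  "position a = card {b. b < a}"

definition word_map :: "'n::{finite,linorder} list \<Rightarrow> 'n \<Rightarrow> 'n" where
  "word_map as a = as ! position a"

lemma levi_civita_word_map:
  "levi_civita (as :: 'n::{finite,linorder} list) =
     (if length as = CARD('n) \<and> distinct as then of_int (sign (word_map as)) else 0)"
  unfolding levi_civita_def word_map_def [abs_def] position_def ..

lemma bij_betw_position: "bij_betw (position :: 'n::{finite,linorder} \<Rightarrow> nat) UNIV {..<CARD('n)}"
proof -
  have less: "position a < position b" if "a < b" for a b :: 'n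
    unfolding position_def using that by (intro psubset_card_mono) auto
  have inj: "inj (position :: 'n \<Rightarrow> nat)"
    by (rule injI) (metis less less_irrefl linorder_neqE)
  have "position a < CARD('n)" for a :: 'n
    unfolding position_def by (intro psubset_card_mono) auto
  then have "range (position :: 'n \<Rightarrow> nat) \<subseteq> {..<CARD('n)}"
    by auto
  then have "range (position :: 'n \<Rightarrow> nat) = {..<CARD('n)}"
    using card_image [OF inj] by (intro card_seteq) auto
  with inj show ?thesis
    by (simp add: bij_betw_def)
qed

lemma position_less: "position (a :: 'n::{finite,linorder}) < CARD('n)"
  using bij_betw_position [where 'n = 'n] by (auto simp: bij_betw_def)

lemma position_eq_iff [simp]: "position a = position b \<longleftrightarrow> a = b"
  using bij_betw_position by (auto simp: bij_betw_def inj_def)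

lemma position_witness:
  assumes "k < CARD('n)"
  obtains a :: "'n::{finite,linorder}" where "position a = k"
proof -
  have "k \<in> range (position :: 'n \<Rightarrow> nat)"
    using assms bij_betw_position [where 'n = 'n] by (simp add: bij_betw_def)
  then show thesis
    using that by auto
qed

lemma word_map_permutes:
  fixes as :: "'n::{finite,linorder} list"
  assumes "length as = CARD('n)" "distinct as"
  shows "word_map as permutes UNIV"
proof -
  have "inj (word_map as)"
    by (rule injI) (simp add: word_map_def assms position_less nth_eq_iff_index_eq)
  then show ?thesis
    by (intro bij_imp_permutes) (auto simp: bij_def finite_UNIV_inj_surj)
qed

lemma bij_betw_word_map:
  "bij_betw word_map {as :: 'n::{finite,linorder} list. length as = CARD('n) \<and> distinct as}
     {p. p permutes UNIV}"
  unfolding bij_betw_def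
proof (intro conjI subset_antisym subsetI)
  show "inj_on word_map {as :: 'n list. length as = CARD('n) \<and> distinct as}"
  proof (rule inj_onI, clarify)
    fix as bs :: "'n list"
    assume len: "length as = CARD('n)" "length bs = CARD('n)" and eq: "word_map as = word_map bs"
    have "as ! k = bs ! k" if k: "k < CARD('n)" for k
    proof -
      obtain a :: 'n where "position a = k"
        using position_witness [OF k] .
      then show ?thesis
        using fun_cong [OF eq, of a] by (simp add: word_map_def)
    qed
    with len show "as = bs"
      by (simp add: list_eq_iff_nth_eq)
  qed
next
  fix p :: "'n \<Rightarrow> 'n"
  assume "p \<in> word_map ` {as. length as = CARD('n) \<and> distinct as}"
  then show "p \<in> {p. p permutes UNIV}"
    using word_map_permutes by auto
next
  fix p :: "'n \<Rightarrow> 'n"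
  assume p: "p \<in> {p. p permutes UNIV}"
  define q where "q = inv_into UNIV (position :: 'n \<Rightarrow> nat)"
  have q: "q (position a) = a" for a :: 'n
    unfolding q_def using bij_betw_position by (intro inv_into_f_f) (auto simp: bij_betw_def)
  define as where "as = map (\<lambda>k. p (q k)) [0..<CARD('n)]"
  have "inj_on q {..<CARD('n)}"
    unfolding q_def using bij_betw_inv_into [OF bij_betw_position] by (auto simp: bij_betw_def)
  moreover have "inj p"
    using p permutes_inj by blast
  ultimately have "inj_on (\<lambda>k. p (q k)) {..<CARD('n)}"
    by (auto simp: inj_on_def)
  then have "distinct as"
    by (simp add: as_def distinct_map lessThan_atLeast0)
  moreover have "word_map as = p"
    by (auto simp: word_map_def as_def q position_less)
  ultimately show "p \<in> word_map ` {as. length as = CARD('n) \<and> distinct as}"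
    by (intro image_eqI [of _ _ as]) (auto simp: as_def)
qed

lemma prod_over_positions:
  "(\<Prod>k<CARD('n). f k) = (\<Prod>a\<in>(UNIV :: 'n::{finite,linorder} set). f (position a))"
  using prod.reindex_bij_betw [OF bij_betw_position] by (metis)

lemma finite_multi_indices: "finite (multi_indices r :: 'k::finite list set)"
  using finite_lists_length_eq [OF finite, of UNIV r] by (simp add: multi_indices_def)

text \<open>The Leibniz formula for the matrix whose rows are those of \<open>A\<close> in the order \<open>cs\<close>: a permutation
  of rows changes the sign, a repeated row gives zero, and the Levi-Civita symbol of \<open>cs\<close> covers both.\<close>

lemma det_levi_civita:
  fixes A :: "(real^'n::_)^'n::{finite,linorder}" and cs :: "'n list"
  assumes cs: "length cs = CARD('n)"
  shows "(\<Sum>bs\<in>multi_indices CARD('n). levi_civita bs * (\<Prod>k<CARD('n). A $ (cs ! k) $ (bs ! k)))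
    = det A * levi_civita cs"
proof -
  \<comment> \<open>Only the words without repetition contribute, and these are the permutations.\<close>
  let ?D = "{bs :: 'n list. length bs = CARD('n) \<and> distinct bs}"
  let ?g = "\<lambda>p. of_int (sign p) * (\<Prod>a\<in>UNIV. A $ word_map cs a $ p a)"
  have "(\<Sum>bs\<in>multi_indices CARD('n). levi_civita bs * (\<Prod>k<CARD('n). A $ (cs ! k) $ (bs ! k)))
      = (\<Sum>bs\<in>?D. levi_civita bs * (\<Prod>k<CARD('n). A $ (cs ! k) $ (bs ! k)))"
    by (rule sum.mono_neutral_right)
       (auto simp: finite_multi_indices, auto simp: multi_indices_def levi_civita_word_map split: if_splits)
  also have "\<dots> = (\<Sum>bs\<in>?D. ?g (word_map bs))"
    by (rule sum.cong) (auto simp: levi_civita_word_map prod_over_positions word_map_def)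
  also have "\<dots> = (\<Sum>p\<in>{p. p permutes UNIV}. ?g p)"
    by (rule sum.reindex_bij_betw [OF bij_betw_word_map])
  also have "\<dots> = det (\<chi> a. A $ word_map cs a)"
    by (simp add: det_def)
  also have "\<dots> = det A * levi_civita cs"
  proof (cases "distinct cs")
    case True
    then show ?thesis
      using cs det_permute_rows [OF word_map_permutes [OF cs True], of A]
      by (simp add: levi_civita_word_map)
  next
    case False
    then obtain k l where kl: "k < CARD('n)" "l < CARD('n)" "k \<noteq> l" "cs ! k = cs ! l"
      using cs by (auto simp: distinct_conv_nth)
    obtain a b :: 'n where "position a = k" "position b = l"
      using kl position_witness by metis
    with kl have "det (\<chi> a. A $ word_map cs a) = 0"
      by (intro det_identical_rows [of a b]) (auto simp: row_def word_map_def)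
    with False show ?thesis
      by (simp add: levi_civita_word_map)
  qed
  finally show ?thesis .
qed

text \<open>Exchanging neighbouring letters composes the permutation with a transposition.\<close>

lemma levi_civita_swap:
  fixes ps qs :: "'n::{finite,linorder} list"
  shows "levi_civita (ps @ y # z # qs) = - levi_civita (ps @ z # y # qs)"
proof (cases "length (ps @ y # z # qs) = CARD('n) \<and> distinct (ps @ y # z # qs)")
  case False
  then show ?thesis
    by (auto simp: levi_civita_word_map)
next
  case True
  let ?as = "ps @ y # z # qs" and ?bs = "ps @ z # y # qs"
  have as: "length ?as = CARD('n)" "distinct ?as" and bs: "length ?bs = CARD('n)" "distinct ?bs"
    using True by auto
  have "length ps < CARD('n)" "Suc (length ps) < CARD('n)"
    using as(1) by auto
  then obtain i j :: 'n where ij: "position i = length ps" "position j = Suc (length ps)"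
    using position_witness by metis
  then have "i \<noteq> j"
    by auto
  have "word_map ?as a = word_map ?bs (Transposition.transpose i j a)" for a
  proof -
    consider "a = i" | "a = j" | "a \<noteq> i" "a \<noteq> j" by blast
    then show ?thesis
    proof cases
      case 3
      then have "position a \<noteq> length ps" "position a \<noteq> Suc (length ps)"
        using ij by (metis position_eq_iff)+
      with 3 show ?thesis
        by (auto simp: word_map_def nth_append nth_Cons split: nat.split)
    qed (auto simp: word_map_def ij nth_append)
  qed
  then have "word_map ?as = word_map ?bs \<circ> Transposition.transpose i j"
    by auto
  moreover have "permutation (word_map ?bs)"
    using word_map_permutes [OF bs] by (simp add: permutation_permutes) blast
  ultimately have "sign (word_map ?as) = - sign (word_map ?bs)"
    using \<open>i \<noteq> j\<close> by (simp add: sign_compose permutation_swap_id sign_swap_id)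
  then show ?thesis
    using as bs unfolding levi_civita_word_map by simp
qed

text \<open>The letter \<open>b\<close> passes the letters of \<open>as\<close> one at a time. This accounts for the two positions of
  the free index of the Levi-Civita symbol, first in \<open>\<P>\<close> and last in \<open>\<T>\<close>.\<close>

lemma levi_civita_rotate:
  "levi_civita (ps @ as @ b # qs) = (-1) ^ length as * levi_civita (ps @ b # as @ qs)"
proof (induction as arbitrary: ps)
  case (Cons a as)
  show ?case
    using Cons.IH [of "ps @ [a]"] levi_civita_swap [of ps a b "as @ qs"] by simp
qed simp

text \<open>A word without repetition that uses every letter is determined in its first letter by the others,
  and there are \<open>(n - 1)!\<close> ways to arrange the latter.\<close>

lemma sum_levi_civita_tails:
  fixes a c :: "'n::{finite,linorder}"
  shows "(\<Sum>as\<in>multi_indices (CARD('n) - 1). levi_civita (a # as) * levi_civita (c # as))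
    = (if a = c then fact (CARD('n) - 1) else 0)"
proof -
  let ?r = "CARD('n) - 1"
  let ?D = "\<lambda>a. {as :: 'n list. length as = ?r \<and> distinct as \<and> set as \<subseteq> UNIV - {a}}"
  have pos: "CARD('n) > 0"
    by (simp add: card_gt_0_iff)
  have lc: "levi_civita (a # as) = 0" if "length as = ?r" "as \<notin> ?D a" for as a
    using that pos by (auto simp: levi_civita_word_map)
  have full: "set as = UNIV - {a}" if "as \<in> ?D a" for as a
    by (rule card_subset_eq) (use that in \<open>simp_all add: distinct_card card_Diff_singleton\<close>)
  show ?thesis
  proof (cases "a = c")
    case False
    have "levi_civita (a # as) * levi_civita (c # as) = 0" if "length as = ?r" for as
    proof (rule ccontr)
      assume "\<not> ?thesis"
      then have "as \<in> ?D a" "as \<in> ?D c"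
        using lc [OF that, of a] lc [OF that, of c] by (metis mult_zero_left, metis mult_zero_right)
      then have "UNIV - {a} = UNIV - {c}"
        using full [of as a] full [of as c] by metis
      with False show False
        by blast
    qed
    then show ?thesis
      using False by (auto simp: multi_indices_def intro!: sum.neutral)
  next
    case True
    have sq: "levi_civita (a # as) * levi_civita (a # as) = 1" if "as \<in> ?D a" for as
      using that pos by (auto simp: levi_civita_word_map simp flip: of_int_mult)
    have "(\<Sum>as\<in>multi_indices ?r. levi_civita (a # as) * levi_civita (a # as)) = (\<Sum>as\<in>?D a. 1)"
    proof (rule sum.mono_neutral_cong_right)
      show "\<forall>as\<in>multi_indices ?r - ?D a. levi_civita (a # as) * levi_civita (a # as) = 0"
      proof
        fix as assume "as \<in> multi_indices ?r - ?D a"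
        then have "length as = ?r" "as \<notin> ?D a"
          by (simp_all add: multi_indices_def)
        from lc [OF this] show "levi_civita (a # as) * levi_civita (a # as) = 0"
          by simp
      qed
    qed (simp_all add: finite_multi_indices sq, auto simp: multi_indices_def)
    also have "\<dots> = real (card (?D a))"
      by simp
    also have "card (?D a) = fact ?r"
      using card_lists_distinct_length_eq [of "UNIV - {a}" ?r]
      by (simp add: card_Diff_singleton fact_prod)
    finally show ?thesis
      using True by simp
  qed
qed

lemma sum_multi_indices_Suc:
  "(\<Sum>I\<in>multi_indices (Suc r). f I) = (\<Sum>i\<in>(UNIV :: 'k::finite set). \<Sum>I\<in>multi_indices r. f (i # I))"
proof -
  have "bij_betw (\<lambda>(i, I). i # I) (UNIV \<times> multi_indices r) (multi_indices (Suc r) :: 'k list set)"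
    by (auto simp: bij_betw_def inj_on_def multi_indices_def length_Suc_conv image_iff)
  then show ?thesis
    using sum.reindex_bij_betw [of "\<lambda>(i, I). i # I" _ _ f]
    by (fastforce simp: sum.cartesian_product case_prod_unfold)
qed

text \<open>The contractions in the different slots of a multi-index are independent of each other.\<close>

lemma sum_multi_indices_prod:
  fixes F :: "nat \<Rightarrow> 'k::finite \<Rightarrow> 'k \<Rightarrow> real"
  shows "(\<Sum>I\<in>multi_indices r. \<Sum>J\<in>multi_indices r. \<Prod>k<r. F k (I ! k) (J ! k))
    = (\<Prod>k<r. \<Sum>i\<in>UNIV. \<Sum>j\<in>UNIV. F k i j)"
proof (induction r arbitrary: F)
  case 0
  then show ?case
    by (simp add: multi_indices_def)
next
  case (Suc r)
  have "(\<Sum>I\<in>multi_indices (Suc r). \<Sum>J\<in>multi_indices (Suc r). \<Prod>k<Suc r. F k (I ! k) (J ! k))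
      = (\<Sum>i\<in>UNIV. \<Sum>I\<in>multi_indices r. \<Sum>j\<in>UNIV. \<Sum>J\<in>multi_indices r.
           F 0 i j * (\<Prod>k<r. F (Suc k) (I ! k) (J ! k)))"
    by (simp add: sum_multi_indices_Suc prod.lessThan_Suc_shift del: prod.lessThan_Suc)
  also have "\<dots> = (\<Sum>i\<in>UNIV. \<Sum>j\<in>UNIV. F 0 i j) *
      (\<Sum>I\<in>multi_indices r. \<Sum>J\<in>multi_indices r. \<Prod>k<r. F (Suc k) (I ! k) (J ! k))"
    by (simp add: sum.swap [of _ UNIV "multi_indices r"] sum_distrib_right flip: sum_distrib_left)
  also have "\<dots> = (\<Prod>k<Suc r. \<Sum>i\<in>UNIV. \<Sum>j\<in>UNIV. F k i j)"
    by (simp add: Suc.IH [of "\<lambda>k. F (Suc k)"] prod.lessThan_Suc_shift del: prod.lessThan_Suc)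
  finally show ?case .
qed

lemma matrix_inv_mult:
  fixes A :: "real^'k::finite^'k"
  assumes "invertible A"
  shows "A ** matrix_inv A = mat 1" "matrix_inv A ** A = mat 1"
proof -
  have "A ** matrix_inv A = mat 1 \<and> matrix_inv A ** A = mat 1"
    using assms unfolding invertible_def matrix_inv_def by (rule someI_ex)
  then show "A ** matrix_inv A = mat 1" "matrix_inv A ** A = mat 1"
    by auto
qed

text \<open>Multiplying the left-hand side by \<open>G $ c $ b\<close> and summing over \<open>b\<close> completes the inner sum to a full
  determinant expansion along the word \<open>c # as\<close>; so the left-hand sides form a matrix whose product
  with \<open>G\<close> is a multiple of the identity.\<close>

lemma levi_civita_cofactor:
  fixes G :: "(real^'n::_)^'n::{finite,linorder}"
  assumes G: "invertible G"
  shows "(\<Sum>as\<in>multi_indices (CARD('n) - 1). \<Sum>bs\<in>multi_indices (CARD('n) - 1).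
      levi_civita (a # as) * levi_civita (b # bs) * (\<Prod>k<CARD('n) - 1. G $ (as ! k) $ (bs ! k)))
    = fact (CARD('n) - 1) * det G * matrix_inv G $ b $ a"
proof -
  obtain r where r: "CARD('n) = Suc r"
    using not0_implies_Suc [of "CARD('n)"] by auto
  define C :: "(real^'n::_)^'n::_" where "C = (\<chi> b a. \<Sum>as\<in>multi_indices r. \<Sum>bs\<in>multi_indices r.
      levi_civita (a # as) * levi_civita (b # bs) * (\<Prod>k<r. G $ (as ! k) $ (bs ! k)))"
  have "(\<Sum>b\<in>UNIV. G $ c $ b * C $ b $ a) = (if a = c then fact r * det G else 0)" for a c
  proof -
    have "(\<Sum>b\<in>UNIV. G $ c $ b * C $ b $ a) = (\<Sum>as\<in>multi_indices r. \<Sum>b\<in>UNIV. \<Sum>bs\<in>multi_indices r.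
        levi_civita (a # as) * (levi_civita (b # bs) * (G $ c $ b * (\<Prod>k<r. G $ (as ! k) $ (bs ! k)))))"
      by (subst sum.swap) (simp add: C_def sum_distrib_left mult_ac)
    also have "\<dots> = (\<Sum>as\<in>multi_indices r. levi_civita (a # as) * (\<Sum>bs\<in>multi_indices (Suc r).
        levi_civita bs * (\<Prod>k<Suc r. G $ ((c # as) ! k) $ (bs ! k))))"
      by (simp add: sum_multi_indices_Suc prod.lessThan_Suc_shift sum_distrib_left del: prod.lessThan_Suc)
    also have "\<dots> = (\<Sum>as\<in>multi_indices r. levi_civita (a # as) * (det G * levi_civita (c # as)))"
    proof (rule sum.cong [OF refl])
      fix as :: "'n list" assume "as \<in> multi_indices r"
      then have "length (c # as) = CARD('n)"
        by (simp add: multi_indices_def r)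
      from det_levi_civita [OF this, of G]
      show "levi_civita (a # as) * (\<Sum>bs\<in>multi_indices (Suc r).
          levi_civita bs * (\<Prod>k<Suc r. G $ ((c # as) ! k) $ (bs ! k)))
        = levi_civita (a # as) * (det G * levi_civita (c # as))"
        unfolding r by simp
    qed
    also have "\<dots> = det G * (\<Sum>as\<in>multi_indices r. levi_civita (a # as) * levi_civita (c # as))"
      by (simp add: sum_distrib_left mult_ac)
    also have "\<dots> = (if a = c then fact r * det G else 0)"
      using sum_levi_civita_tails [of a c] by (simp add: r)
    finally show ?thesis .
  qed
  then have "G ** C = (fact r * det G) *\<^sub>R mat 1"
    by (auto simp: vec_eq_iff matrix_matrix_mult_def mat_def)
  moreover have "matrix_inv G ** (c *\<^sub>R mat 1) = c *\<^sub>R matrix_inv G" for c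
    by (simp add: vec_eq_iff matrix_matrix_mult_def mat_def if_distrib sum.delta cong: if_cong)
  ultimately have "matrix_inv G ** (G ** C) = (fact r * det G) *\<^sub>R matrix_inv G"
    by metis
  then have "C = (fact r * det G) *\<^sub>R matrix_inv G"
    by (simp add: matrix_mul_assoc matrix_inv_mult [OF G])
  then have "C $ b $ a = fact r * det G * matrix_inv G $ b $ a"
    by simp
  then show ?thesis
    by (simp add: C_def r)
qed

section \<open>Partial derivatives of smooth functions\<close>

text \<open>The functions agree near \<open>u\<close>, so they have the same derivatives; if there is none, then
  \<open>frechet_derivative\<close> makes the same arbitrary choice for both.\<close>

lemma frechet_derivative_cong_open:
  assumes "open S" "u \<in> S" "\<And>v. v \<in> S \<Longrightarrow> f v = g v"
  shows "frechet_derivative f (at u) = frechet_derivative g (at u)"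
proof -
  have "(f has_derivative D) (at u) \<longleftrightarrow> (g has_derivative D) (at u)" for D
    using assms by (metis has_derivative_transform_within_open)
  then show ?thesis
    by (simp add: frechet_derivative_def)
qed

lemma partial_cong_open:
  assumes "open S" "u \<in> S" "\<And>v. v \<in> S \<Longrightarrow> f v = g v"
  shows "partial a f u = partial a g u"
  unfolding partial_def by (subst frechet_derivative_cong_open [OF assms]) simp_all

lemma differentiable_cong_open:
  assumes "f differentiable (at u)" "open S" "u \<in> S" "\<And>v. v \<in> S \<Longrightarrow> f v = g v"
  shows "g differentiable (at u)"
  using assms unfolding differentiable_def by (metis has_derivative_transform_within_open)

lemma higher_diff_on_cong:
  assumes "open S" "\<And>v. v \<in> S \<Longrightarrow> f v = g v" "higher_diff_on S f k"
  shows "higher_diff_on S g k"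
  using assms(2,3)
proof (induction k arbitrary: f g)
  case 0
  then show ?case
    by (auto intro: continuous_on_eq)
next
  case (Suc k)
  have "g differentiable (at u)" if "u \<in> S" for u
    using Suc.prems that assms(1) by (auto intro: differentiable_cong_open [of f u S])
  moreover have "higher_diff_on S (\<lambda>u. frechet_derivative g (at u) v) k" for v
  proof (rule Suc.IH)
    show "higher_diff_on S (\<lambda>u. frechet_derivative f (at u) v) k"
      using Suc.prems by simp
    show "frechet_derivative f (at u) v = frechet_derivative g (at u) v" if "u \<in> S" for u
      by (subst frechet_derivative_cong_open [OF assms(1) that Suc.prems(1)]) simp_all
  qed
  ultimately show ?case
    by simp
qed

lemma higher_diff_on_linear_image:
  assumes "bounded_linear L" "open S" "higher_diff_on S f k"
  shows "higher_diff_on S (\<lambda>u. L (f u)) k"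
  using assms(3)
proof (induction k arbitrary: f)
  case 0
  then show ?case
    using assms(1) by (auto intro: bounded_linear.continuous_on)
next
  case (Suc k)
  have D: "((\<lambda>u. L (f u)) has_derivative (\<lambda>v. L (frechet_derivative f (at u) v))) (at u)" if "u \<in> S" for u
    using Suc.prems that by (intro bounded_linear.has_derivative [OF assms(1)]) (auto simp: frechet_derivative_works)
  have "higher_diff_on S (\<lambda>u. frechet_derivative (\<lambda>u. L (f u)) (at u) v) k" for v
  proof (rule higher_diff_on_cong [OF assms(2)])
    show "higher_diff_on S (\<lambda>u. L (frechet_derivative f (at u) v)) k"
      using Suc by simp
    show "L (frechet_derivative f (at u) v) = frechet_derivative (\<lambda>u. L (f u)) (at u) v" if "u \<in> S" for u
      using frechet_derivative_at [OF D [OF that]] by metis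
  qed
  with D show ?case
    by (auto intro: differentiableI)
qed

lemma higher_diff_on_subset:
  "higher_diff_on T f k \<Longrightarrow> S \<subseteq> T \<Longrightarrow> higher_diff_on S f k"
  by (induction k arbitrary: f) (auto intro: continuous_on_subset)

lemma smooth_on_subset: "smooth_on T f \<Longrightarrow> S \<subseteq> T \<Longrightarrow> smooth_on S f"
  by (auto simp: smooth_on_def intro: higher_diff_on_subset)

lemma smooth_on_nth: "smooth_on S f \<Longrightarrow> open S \<Longrightarrow> smooth_on S (\<lambda>u. f u $ i)"
  by (auto simp: smooth_on_def intro: higher_diff_on_linear_image [OF bounded_linear_vec_nth])

lemma smooth_on_partial:
  assumes "smooth_on S f"
  shows "smooth_on S (partial a f)"
proof -
  have "higher_diff_on S (\<lambda>u. partial a f u) k" for k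
    using assms [unfolded smooth_on_def, rule_format, of "Suc k"] by (simp add: partial_def)
  then show ?thesis
    by (simp add: smooth_on_def)
qed

lemma smooth_on_differentiable: "smooth_on S f \<Longrightarrow> u \<in> S \<Longrightarrow> f differentiable (at u)"
  unfolding smooth_on_def by (drule spec [of _ "Suc 0"]) auto

lemma smooth_on_continuous_on: "smooth_on S f \<Longrightarrow> continuous_on S f"
  unfolding smooth_on_def by (drule spec [of _ 0]) auto

lemma smooth_on_ident: "smooth_on S (\<lambda>u. u)"
proof -
  have const: "higher_diff_on S (\<lambda>u. c) k" for k and c :: 'a
    by (induction k arbitrary: c) auto
  have "higher_diff_on S (\<lambda>u. u) k" for k
    by (cases k) (auto simp: const)
  then show ?thesis
    by (simp add: smooth_on_def)
qed

lemma partial_has_derivative: "(f has_derivative f') (at u) \<Longrightarrow> partial a f u = f' (axis a 1)"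
  unfolding partial_def by (metis frechet_derivative_at)

lemma partial_const [simp]: "partial a (\<lambda>v. c) u = 0"
  by (simp add: partial_def)

lemma partial_add:
  "f differentiable (at u) \<Longrightarrow> g differentiable (at u) \<Longrightarrow>
    partial a (\<lambda>v. f v + g v) u = partial a f u + partial a g u"
  unfolding frechet_derivative_works
  by (subst partial_has_derivative, rule derivative_intros) (auto simp: partial_def)

lemma partial_sum:
  "finite I \<Longrightarrow> (\<And>i. i \<in> I \<Longrightarrow> f i differentiable (at u)) \<Longrightarrow>
    partial a (\<lambda>v. \<Sum>i\<in>I. f i v) u = (\<Sum>i\<in>I. partial a (f i) u)"
  unfolding frechet_derivative_works
  by (subst partial_has_derivative, rule derivative_intros) (auto simp: partial_def)

lemma partial_mult:
  fixes f g :: "real^'k::finite \<Rightarrow> real"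
  shows "f differentiable (at u) \<Longrightarrow> g differentiable (at u) \<Longrightarrow>
    partial a (\<lambda>v. f v * g v) u = partial a f u * g u + f u * partial a g u"
  unfolding frechet_derivative_works
  by (subst partial_has_derivative, rule derivative_intros) (auto simp: partial_def)

lemma linear_vec_expand:
  fixes f :: "real^'k::finite \<Rightarrow> real"
  assumes "linear f"
  shows "f w = (\<Sum>j\<in>UNIV. f (axis j 1) * w $ j)"
proof -
  have "f w = f (\<Sum>j\<in>UNIV. w $ j *\<^sub>R axis j 1)"
    using basis_expansion [of w] by (simp add: scalar_mult_eq_scaleR)
  then show ?thesis
    using assms by (simp add: linear_sum linear_cmul mult.commute)
qed

lemma partial_chain:
  fixes f :: "real^'l::finite \<Rightarrow> real" and x :: "real^'k::finite \<Rightarrow> real^'l"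
  assumes f: "f differentiable (at (x u))" and x: "x differentiable (at u)"
  shows "partial a (\<lambda>v. f (x v)) u = (\<Sum>j\<in>UNIV. partial j f (x u) * partial a (\<lambda>v. x v $ j) u)"
proof -
  let ?f' = "frechet_derivative f (at (x u))" and ?x' = "frechet_derivative x (at u)"
  have "((\<lambda>v. f (x v)) has_derivative (\<lambda>w. ?f' (?x' w))) (at u)"
    using f x unfolding frechet_derivative_works by (metis has_derivative_compose)
  then have "partial a (\<lambda>v. f (x v)) u = ?f' (?x' (axis a 1))"
    by (rule partial_has_derivative)
  also have "\<dots> = (\<Sum>j\<in>UNIV. partial j f (x u) * ?x' (axis a 1) $ j)"
    by (subst linear_vec_expand [OF linear_frechet_derivative [OF f]]) (simp add: partial_def)
  finally have "partial a (\<lambda>v. f (x v)) u = (\<Sum>j\<in>UNIV. partial j f (x u) * ?x' (axis a 1) $ j)" .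
  moreover have "?x' (axis a 1) $ j = partial a (\<lambda>v. x v $ j) u" for j
  proof -
    have "((\<lambda>v. x v $ j) has_derivative (\<lambda>w. ?x' w $ j)) (at u)"
      using x unfolding frechet_derivative_works
      by (rule bounded_linear.has_derivative [OF bounded_linear_vec_nth])
    then show ?thesis
      by (simp add: partial_has_derivative)
  qed
  ultimately show ?thesis
    by simp
qed

lemma has_real_derivative_along_axis:
  fixes f :: "real^'k::finite \<Rightarrow> real"
  assumes "f differentiable (at (w + t *\<^sub>R axis a 1))"
  shows "((\<lambda>t. f (w + t *\<^sub>R axis a 1)) has_real_derivative partial a f (w + t *\<^sub>R axis a 1)) (at t)"
proof -
  let ?p = "w + t *\<^sub>R axis a 1"
  have lin: "linear (frechet_derivative f (at ?p))"
    using assms by (rule linear_frechet_derivative)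
  have "((\<lambda>t. w + t *\<^sub>R axis a 1) has_derivative (\<lambda>t. t *\<^sub>R axis a 1)) (at t)"
    by (auto intro!: derivative_eq_intros)
  then have "((\<lambda>t. f (w + t *\<^sub>R axis a 1)) has_derivative
      (\<lambda>t. frechet_derivative f (at ?p) (t *\<^sub>R axis a 1))) (at t)"
    using assms unfolding frechet_derivative_works by (rule has_derivative_compose)
  moreover have "(\<lambda>t. frechet_derivative f (at ?p) (t *\<^sub>R axis a 1)) = (*) (partial a f ?p)"
    by (simp add: fun_eq_iff partial_def linear_cmul [OF lin])
  ultimately show ?thesis
    by (simp add: has_field_derivative_def)
qed

text \<open>Two applications of the mean value theorem. The left-hand side does not change when \<open>a\<close> and \<open>b\<close>
  are exchanged while the order of differentiation on the right does: this gives Schwarz's theorem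
  when \<open>s\<close> tends to zero.\<close>

lemma second_difference:
  fixes f :: "real^'k::finite \<Rightarrow> real"
  assumes f: "smooth_on (ball u r) f" and s: "0 < s" "2 * s < r"
  obtains p where "p \<in> ball u r" and
    "f (u + s *\<^sub>R axis a 1 + s *\<^sub>R axis b 1) - f (u + s *\<^sub>R axis a 1) - f (u + s *\<^sub>R axis b 1) + f u
       = s * s * partial b (partial a f) p"
proof -
  let ?a = "axis a 1 :: real^'k" and ?b = "axis b 1 :: real^'k"
  have mem: "u + t *\<^sub>R ?a + t' *\<^sub>R ?b \<in> ball u r" if "0 \<le> t" "t \<le> s" "0 \<le> t'" "t' \<le> s" for t t'
  proof -
    have "norm (t *\<^sub>R ?a + t' *\<^sub>R ?b) \<le> t + t'"
      using that norm_triangle_ineq [of "t *\<^sub>R ?a" "t' *\<^sub>R ?b"] by (simp add: norm_axis_1)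
    then have "norm (t *\<^sub>R ?a + t' *\<^sub>R ?b) < r"
      using that s by linarith
    then show ?thesis
      unfolding mem_ball dist_norm norm_minus_commute [of u] by (simp add: add.assoc)
  qed
  have diff: "g differentiable (at (u + t *\<^sub>R ?a + t' *\<^sub>R ?b))"
    if "smooth_on (ball u r) g" "0 \<le> t" "t \<le> s" "0 \<le> t'" "t' \<le> s" for g :: "real^'k \<Rightarrow> real" and t t'
    by (intro smooth_on_differentiable [OF that(1)] mem that(2-5))
  have "\<exists>z. 0 < z \<and> z < s \<and>
     (f (u + s *\<^sub>R ?a + s *\<^sub>R ?b) - f (u + s *\<^sub>R ?a)) - (f (u + 0 *\<^sub>R ?a + s *\<^sub>R ?b) - f (u + 0 *\<^sub>R ?a))
       = (s - 0) * (partial a f (u + z *\<^sub>R ?a + s *\<^sub>R ?b) - partial a f (u + z *\<^sub>R ?a))"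
  proof (rule MVT2 [OF s(1)])
    fix t assume t: "0 \<le> t" "t \<le> s"
    have swap: "u + t *\<^sub>R ?a + s *\<^sub>R ?b = (u + s *\<^sub>R ?b) + t *\<^sub>R ?a" for t
      by (simp add: add_ac)
    have "f differentiable (at ((u + s *\<^sub>R ?b) + t *\<^sub>R ?a))" "f differentiable (at (u + t *\<^sub>R ?a))"
      using diff [OF f t, of s] diff [OF f t, of 0] s(1) unfolding swap by simp_all
    from this [THEN has_real_derivative_along_axis]
    show "((\<lambda>t. f (u + t *\<^sub>R ?a + s *\<^sub>R ?b) - f (u + t *\<^sub>R ?a)) has_real_derivative
        partial a f (u + t *\<^sub>R ?a + s *\<^sub>R ?b) - partial a f (u + t *\<^sub>R ?a)) (at t)"
      unfolding swap by (rule DERIV_diff)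
  qed
  then obtain z where z: "0 < z" "z < s" and
    1: "f (u + s *\<^sub>R ?a + s *\<^sub>R ?b) - f (u + s *\<^sub>R ?a) - (f (u + s *\<^sub>R ?b) - f u)
       = s * (partial a f (u + z *\<^sub>R ?a + s *\<^sub>R ?b) - partial a f (u + z *\<^sub>R ?a))"
    unfolding scaleR_zero_left add_0_right diff_zero by blast
  have "\<exists>y. 0 < y \<and> y < s \<and>
     partial a f (u + z *\<^sub>R ?a + s *\<^sub>R ?b) - partial a f (u + z *\<^sub>R ?a + 0 *\<^sub>R ?b)
       = (s - 0) * partial b (partial a f) (u + z *\<^sub>R ?a + y *\<^sub>R ?b)"
  proof (rule MVT2 [OF s(1)])
    fix t assume t: "0 \<le> t" "t \<le> s"
    show "((\<lambda>t. partial a f (u + z *\<^sub>R ?a + t *\<^sub>R ?b)) has_real_derivative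
        partial b (partial a f) (u + z *\<^sub>R ?a + t *\<^sub>R ?b)) (at t)"
      using diff [OF smooth_on_partial [OF f], of z t] z t
      by (intro has_real_derivative_along_axis [of "partial a f"]) simp
  qed
  then obtain y where y: "0 < y" "y < s" and
    2: "partial a f (u + z *\<^sub>R ?a + s *\<^sub>R ?b) - partial a f (u + z *\<^sub>R ?a)
       = s * partial b (partial a f) (u + z *\<^sub>R ?a + y *\<^sub>R ?b)"
    unfolding scaleR_zero_left add_0_right diff_zero by blast
  show thesis
  proof (rule that)
    show "u + z *\<^sub>R ?a + y *\<^sub>R ?b \<in> ball u r"
      using mem [of z y] y z by simp
    show "f (u + s *\<^sub>R ?a + s *\<^sub>R ?b) - f (u + s *\<^sub>R ?a) - f (u + s *\<^sub>R ?b) + f u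
        = s * s * partial b (partial a f) (u + z *\<^sub>R ?a + y *\<^sub>R ?b)"
      using 1 unfolding 2 mult.assoc by linarith
  qed
qed

lemma partial_commute:
  fixes f :: "real^'k::finite \<Rightarrow> real"
  assumes f: "smooth_on S f" and S: "open S" "u \<in> S"
  shows "partial a (partial b f) u = partial b (partial a f) u"
proof (rule ccontr)
  let ?F = "partial a (partial b f)" and ?G = "partial b (partial a f)"
  assume neq: "?F u \<noteq> ?G u"
  define e where "e = dist (?F u) (?G u) / 2"
  have e: "e > 0"
    using neq by (simp add: e_def)
  have "isCont ?F u" "isCont ?G u"
    using smooth_on_continuous_on [OF smooth_on_partial [OF smooth_on_partial [OF f]]] S
    by (auto simp: continuous_on_eq_continuous_at)
  with e have "\<exists>d>0. \<forall>p. dist p u < d \<longrightarrow> dist (?F p) (?F u) < e"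
    "\<exists>d>0. \<forall>p. dist p u < d \<longrightarrow> dist (?G p) (?G u) < e"
    by (simp_all add: continuous_at_eps_delta)
  then obtain d d' where d: "d > 0" "\<And>p. dist p u < d \<Longrightarrow> dist (?F p) (?F u) < e"
    and d': "d' > 0" "\<And>p. dist p u < d' \<Longrightarrow> dist (?G p) (?G u) < e"
    by auto
  obtain r0 where r0: "r0 > 0" "ball u r0 \<subseteq> S"
    using S by (auto elim: openE)
  define r where "r = min r0 (min d d')"
  have "ball u r \<subseteq> S"
    using r0(2) by (auto simp: r_def)
  with r0 d(1) d'(1) have r: "r > 0" "smooth_on (ball u r) f"
    using smooth_on_subset [OF f] by (simp_all add: r_def)
  \<comment> \<open>A square of side \<open>r / 3\<close> with corner \<open>u\<close> lies in the ball of radius \<open>r\<close>.\<close>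
  define s where "s = r / 3"
  have s: "0 < s" "2 * s < r"
    using r by (auto simp: s_def)
  obtain p where p: "p \<in> ball u r" "f (u + s *\<^sub>R axis a 1 + s *\<^sub>R axis b 1)
      - f (u + s *\<^sub>R axis a 1) - f (u + s *\<^sub>R axis b 1) + f u = s * s * ?G p"
    using second_difference [OF r(2) s] by blast
  obtain q where q: "q \<in> ball u r" "f (u + s *\<^sub>R axis b 1 + s *\<^sub>R axis a 1)
      - f (u + s *\<^sub>R axis b 1) - f (u + s *\<^sub>R axis a 1) + f u = s * s * ?F q"
    using second_difference [OF r(2) s] by blast
  have "u + s *\<^sub>R axis b 1 + s *\<^sub>R axis a 1 = u + s *\<^sub>R axis a 1 + s *\<^sub>R axis b 1"
    by (simp add: add_ac)
  from q(2) [unfolded this] p(2) have "s * s * ?F q = s * s * ?G p"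
    by linarith
  then have "?F q = ?G p"
    using s by simp
  moreover have "dist q u < d" "dist p u < d'"
    using p(1) q(1) unfolding mem_ball dist_commute [of u] r_def by simp_all
  then have "dist (?F q) (?F u) < e" "dist (?G p) (?G u) < e"
    by (simp_all only: d(2) d'(2))
  ultimately have "dist (?F q) (?F u) < e" "dist (?F q) (?G u) < e"
    by simp_all
  then have "dist (?F u) (?G u) < e + e"
    using dist_triangle3 [of "?F u" "?G u" "?F q"] by linarith
  then show False
    by (simp add: e_def)
qed

section \<open>Metric, connection and curvature at a point\<close>

lemma metric_prod_inner: "metric_prod G v w = v \<bullet> (G *v w)"
  by (simp add: metric_prod_def inner_vec_def matrix_vector_mult_def sum_distrib_left mult_ac)

lemma metric_prod_add_left: "metric_prod G (v + v') w = metric_prod G v w + metric_prod G v' w"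
  and metric_prod_diff_left: "metric_prod G (v - v') w = metric_prod G v w - metric_prod G v' w"
  and metric_prod_scaleR_left: "metric_prod G (c *\<^sub>R v) w = c * metric_prod G v w"
  and metric_prod_sum_left: "metric_prod G (\<Sum>i\<in>I. f i) w = (\<Sum>i\<in>I. metric_prod G (f i) w)"
  and metric_prod_add_right: "metric_prod G w (v + v') = metric_prod G w v + metric_prod G w v'"
  and metric_prod_scaleR_right: "metric_prod G w (c *\<^sub>R v) = c * metric_prod G w v"
  and metric_prod_sum_right: "metric_prod G w (\<Sum>i\<in>I. f i) = (\<Sum>i\<in>I. metric_prod G w (f i))"
  by (simp_all add: metric_prod_inner algebra_simps inner_sum_left matrix_vector_mult_scaleR
      matrix_vector_right_distrib matrix_vector_mult_diff_distrib inner_sum_right inner_diff_left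
      inner_diff_right linear_sum [OF matrix_vector_mul_linear])

lemma metric_prod_commute:
  assumes "transpose G = G"
  shows "metric_prod G v w = metric_prod G w v"
  using assms by (metis metric_prod_inner dot_lmul_matrix transpose_matrix_vector inner_commute)

lemma metric_prod_axis: "metric_prod G (axis a 1) (axis b 1) = G $ a $ b"
  by (simp add: metric_prod_inner inner_axis' matrix_vector_mul_component inner_axis)

lemma invertible_if_positive:
  fixes G :: "real^'k::finite^'k"
  assumes "\<And>v. v \<noteq> 0 \<Longrightarrow> v \<bullet> (G *v v) > 0"
  shows "invertible G"
proof -
  have "v = 0" if "G *v v = 0" for v
    using assms [of v] that by fastforce
  then show ?thesis
    by (simp add: invertible_left_inverse matrix_left_invertible_ker)
qed

definition connection ::
  "(real^'k \<Rightarrow> real^'k^'k) \<Rightarrow> real^'k::finite \<Rightarrow> real^'k \<Rightarrow> real^'k \<Rightarrow> real^'k" where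
  "connection G y v w = (\<chi> i. \<Sum>j\<in>UNIV. \<Sum>k\<in>UNIV. christoffel G y i j k * v $ j * w $ k)"

text \<open>The Christoffel symbols enter bilinearly; \<open>connection_deriv\<close> differentiates their coefficients in
  the direction \<open>z\<close>, with the arguments \<open>v\<close> and \<open>w\<close> held fixed.\<close>

definition connection_deriv ::
  "(real^'k \<Rightarrow> real^'k^'k) \<Rightarrow> real^'k::finite \<Rightarrow> real^'k \<Rightarrow> real^'k \<Rightarrow> real^'k \<Rightarrow> real^'k" where
  "connection_deriv G y z v w = (\<chi> i. \<Sum>j\<in>UNIV. \<Sum>k\<in>UNIV.
     (\<Sum>l\<in>UNIV. partial l (\<lambda>y. christoffel G y i j k) y * z $ l) * v $ j * w $ k)"

lemma cov_deriv_along_connection: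
  "cov_deriv_along G x a Y u = tangent_basis Y a u + connection G (x u) (tangent_basis x a u) (Y u)"
  by (simp add: cov_deriv_along_def tangent_basis_def connection_def vec_eq_iff)

lemma connection_add_right: "connection G y v (w + w') = connection G y v w + connection G y v w'"
  by (simp add: connection_def vec_eq_iff sum.distrib algebra_simps)

lemma connection_zero [simp]: "connection G y 0 w = 0"
  by (simp add: connection_def vec_eq_iff)

text \<open>Curvature involves two derivatives of the metric. With this regularity an induced metric qualifies as
  soon as its first derivatives are expressed through differentiable functions.\<close>

definition C2_metric_on :: "(real^'k) set \<Rightarrow> (real^'k::finite \<Rightarrow> real^'k^'k) \<Rightarrow> bool" where
  "C2_metric_on W G \<longleftrightarrow> open W \<and>
     (\<forall>y\<in>W. transpose (G y) = G y \<and> (\<forall>v. v \<noteq> 0 \<longrightarrow> v \<bullet> (G y *v v) > 0) \<and>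
        (\<forall>i j. (\<lambda>z. G z $ i $ j) differentiable (at y) \<and>
           (\<forall>k. partial k (\<lambda>z. G z $ i $ j) differentiable (at y))))"

lemma C2_metric_onD:
  assumes "C2_metric_on W G" "y \<in> W"
  shows "open W" "transpose (G y) = G y" "G y $ i $ j = G y $ j $ i" "invertible (G y)"
    "(\<lambda>z. G z $ i $ j) differentiable (at y)" "partial k (\<lambda>z. G z $ i $ j) differentiable (at y)"
proof -
  show "transpose (G y) = G y"
    using assms by (simp add: C2_metric_on_def)
  then have "transpose (G y) $ j $ i = G y $ j $ i"
    by simp
  then show "G y $ i $ j = G y $ j $ i"
    by (simp add: transpose_def)
  show "invertible (G y)"
    using assms by (intro invertible_if_positive) (simp add: C2_metric_on_def)
qed (use assms in \<open>simp_all add: C2_metric_on_def\<close>)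

lemma differentiable_prod_real:
  fixes f :: "'i \<Rightarrow> 'a::real_normed_vector \<Rightarrow> real"
  assumes "\<And>i. i \<in> I \<Longrightarrow> f i differentiable (at y)"
  shows "(\<lambda>z. \<Prod>i\<in>I. f i z) differentiable (at y)"
  using assms by (induction I rule: infinite_finite_induct) auto

lemma differentiable_det:
  fixes A :: "'a::real_normed_vector \<Rightarrow> real^'k::finite^'k"
  assumes "\<And>i j. (\<lambda>z. A z $ i $ j) differentiable (at y)"
  shows "(\<lambda>z. det (A z)) differentiable (at y)"
  unfolding det_def
  by (intro differentiable_sum ballI differentiable_mult differentiable_const differentiable_prod_real
      assms finite_permutations finite)

text \<open>By Cramer's rule the entries of the inverse are quotients of determinants.\<close>

lemma differentiable_matrix_inv:
  fixes A :: "'a::real_normed_vector \<Rightarrow> real^'k::finite^'k"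
  assumes A: "\<And>i j. (\<lambda>z. A z $ i $ j) differentiable (at y)"
    and S: "open S" "y \<in> S" and inv: "\<And>z. z \<in> S \<Longrightarrow> invertible (A z)"
  shows "(\<lambda>z. matrix_inv (A z) $ i $ l) differentiable (at y)"
proof (rule differentiable_cong_open [OF _ S])
  let ?q = "\<lambda>z. det (\<chi> r j. if j = i then axis l 1 $ r else A z $ r $ j) / det (A z)"
  have "(\<lambda>z. (\<chi> r j. if j = i then axis l 1 $ r else A z $ r $ j) $ r' $ j') differentiable (at y)" for r' j'
    using A by (cases "j' = i") auto
  then show "?q differentiable (at y)"
    using A inv [OF S(2)] by (intro differentiable_divide differentiable_det) (auto simp: invertible_det_nz)
  fix z assume "z \<in> S"
  then have "invertible (A z)"
    by (rule inv)
  then have "A z *v (matrix_inv (A z) *v axis l 1) = axis l 1"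
    by (simp add: matrix_vector_mul_assoc matrix_inv_mult)
  then have "matrix_inv (A z) *v axis l 1 =
      (\<chi> k. det (\<chi> r j. if j = k then axis l 1 $ r else A z $ r $ j) / det (A z))"
    using \<open>invertible (A z)\<close> by (simp add: cramer invertible_det_nz)
  then have "(matrix_inv (A z) *v axis l 1) $ i = ?q z"
    by simp
  then show "?q z = matrix_inv (A z) $ i $ l"
    by (simp add: matrix_vector_mul_component inner_axis)
qed

lemma christoffel_commute:
  assumes G: "C2_metric_on W G" "y \<in> W"
  shows "christoffel G y i j k = christoffel G y i k j"
proof -
  have "partial l (\<lambda>z. G z $ j $ k) y = partial l (\<lambda>z. G z $ k $ j) y" for l
    by (rule partial_cong_open [OF C2_metric_onD(1) [OF G] G(2)]) (rule C2_metric_onD(3) [OF G(1)])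
  then show ?thesis
    by (simp add: christoffel_def add.commute)
qed

lemma connection_commute:
  assumes "C2_metric_on W G" "y \<in> W"
  shows "connection G y v w = connection G y w v"
  unfolding connection_def vec_eq_iff
  by (subst sum.swap) (simp add: christoffel_commute [OF assms] mult_ac)

lemma christoffel_differentiable:
  assumes G: "C2_metric_on W G" "y \<in> W"
  shows "(\<lambda>z. christoffel G z i j k) differentiable (at y)"
  unfolding christoffel_def
  by (intro differentiable_mult differentiable_const differentiable_sum differentiable_add
      differentiable_diff finite ballI C2_metric_onD [OF G] differentiable_matrix_inv)
     (use G C2_metric_onD in auto)

lemma christoffel_lower:
  assumes G: "C2_metric_on W G" "y \<in> W"
  shows "(\<Sum>i\<in>UNIV. G y $ p $ i * christoffel G y i j k) =
    (partial j (\<lambda>z. G z $ p $ k) y + partial k (\<lambda>z. G z $ p $ j) y - partial p (\<lambda>z. G z $ j $ k) y) / 2"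
proof -
  define F :: "real^'a" where "F = (\<chi> l. (partial j (\<lambda>z. G z $ l $ k) y
      + partial k (\<lambda>z. G z $ l $ j) y - partial l (\<lambda>z. G z $ j $ k) y) / 2)"
  have "(\<chi> i. christoffel G y i j k) = matrix_inv (G y) *v F"
    by (simp add: vec_eq_iff christoffel_def F_def matrix_vector_mult_def sum_distrib_left)
  then have "G y *v (\<chi> i. christoffel G y i j k) = F"
    by (simp add: matrix_vector_mul_assoc matrix_inv_mult C2_metric_onD [OF G])
  then have "(G y *v (\<chi> i. christoffel G y i j k)) $ p = F $ p"
    by simp
  then show ?thesis
    by (simp add: matrix_vector_mult_def F_def)
qed

lemma sum_rotate: "(\<Sum>i\<in>I. \<Sum>j\<in>J. \<Sum>k\<in>K. F i j k) = (\<Sum>j\<in>J. \<Sum>k\<in>K. \<Sum>i\<in>I. F i j k)"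
  by (rule trans [OF sum.swap], rule sum.cong [OF refl], rule sum.swap)

lemma metric_prod_connection:
  assumes G: "C2_metric_on W G" "y \<in> W"
  shows "metric_prod (G y) Y (connection G y v Z) =
    (\<Sum>p\<in>UNIV. \<Sum>j\<in>UNIV. \<Sum>k\<in>UNIV. (partial j (\<lambda>z. G z $ p $ k) y + partial k (\<lambda>z. G z $ p $ j) y
       - partial p (\<lambda>z. G z $ j $ k) y) / 2 * Y $ p * v $ j * Z $ k)"
proof -
  have "metric_prod (G y) Y (connection G y v Z) =
      (\<Sum>p\<in>UNIV. \<Sum>i\<in>UNIV. \<Sum>j\<in>UNIV. \<Sum>k\<in>UNIV. G y $ p $ i * christoffel G y i j k * (Y $ p * v $ j * Z $ k))"
    by (simp add: metric_prod_def connection_def sum_distrib_left mult_ac)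
  also have "\<dots> = (\<Sum>p\<in>UNIV. \<Sum>j\<in>UNIV. \<Sum>k\<in>UNIV. (\<Sum>i\<in>UNIV. G y $ p $ i * christoffel G y i j k) * (Y $ p * v $ j * Z $ k))"
    unfolding sum_distrib_right by (rule sum.cong [OF refl], rule sum_rotate)
  finally show ?thesis
    unfolding christoffel_lower [OF G] by (simp add: mult.assoc)
qed

text \<open>Compatibility of the Levi-Civita connection with the metric, as an identity between vectors at one
  point. In this form it also serves vector fields along a map, which are not fields on the ambient
  domain. On the left the coefficients of the metric are differentiated in the direction \<open>v\<close>.\<close>

lemma metric_prod_deriv:
  assumes G: "C2_metric_on W G" "y \<in> W"
  shows "metric_prod (\<chi> i j. \<Sum>l\<in>UNIV. partial l (\<lambda>z. G z $ i $ j) y * v $ l) Y Z =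
    metric_prod (G y) (connection G y v Y) Z + metric_prod (G y) Y (connection G y v Z)"
proof -
  let ?d = "\<lambda>l i j. partial l (\<lambda>z. G z $ i $ j) y"
  have sym: "?d l i j = ?d l j i" for l i j
    by (rule partial_cong_open [OF C2_metric_onD(1) [OF G] G(2)]) (rule C2_metric_onD(3) [OF G(1)])
  have "metric_prod (G y) (connection G y v Y) Z = metric_prod (G y) Z (connection G y v Y)"
    by (rule metric_prod_commute) (rule C2_metric_onD [OF G])
  also have "\<dots> = (\<Sum>p\<in>UNIV. \<Sum>j\<in>UNIV. \<Sum>k\<in>UNIV. (?d j p k + ?d k p j - ?d p j k) / 2 * Z $ p * v $ j * Y $ k)"
    by (rule metric_prod_connection [OF G])
  also have "\<dots> = (\<Sum>k\<in>UNIV. \<Sum>j\<in>UNIV. \<Sum>p\<in>UNIV. (?d j p k + ?d k p j - ?d p j k) / 2 * Z $ p * v $ j * Y $ k)"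
    by (rule trans [OF sum_rotate], rule trans [OF sum.swap], rule refl)
  finally have 1: "metric_prod (G y) (connection G y v Y) Z =
     (\<Sum>p\<in>UNIV. \<Sum>j\<in>UNIV. \<Sum>k\<in>UNIV. (?d j k p + ?d p k j - ?d k j p) / 2 * Z $ k * v $ j * Y $ p)" .
  have "metric_prod (\<chi> i j. \<Sum>l\<in>UNIV. ?d l i j * v $ l) Y Z =
      (\<Sum>p\<in>UNIV. \<Sum>k\<in>UNIV. \<Sum>j\<in>UNIV. ?d j p k * v $ j * Y $ p * Z $ k)"
    by (simp add: metric_prod_def sum_distrib_right)
  also have "\<dots> = (\<Sum>p\<in>UNIV. \<Sum>j\<in>UNIV. \<Sum>k\<in>UNIV. ?d j p k * v $ j * Y $ p * Z $ k)"
    by (rule sum.cong [OF refl]) (rule sum.swap)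
  also have "\<dots> = (\<Sum>p\<in>UNIV. \<Sum>j\<in>UNIV. \<Sum>k\<in>UNIV.
      (?d j k p + ?d p k j - ?d k j p) / 2 * Z $ k * v $ j * Y $ p
      + (?d j p k + ?d k p j - ?d p j k) / 2 * Y $ p * v $ j * Z $ k)"
  proof (intro sum.cong refl)
    fix p j k
    show "?d j p k * v $ j * Y $ p * Z $ k = (?d j k p + ?d p k j - ?d k j p) / 2 * Z $ k * v $ j * Y $ p
      + (?d j p k + ?d k p j - ?d p j k) / 2 * Y $ p * v $ j * Z $ k"
      unfolding sym [of j k p] sym [of p k j] sym [of k j p] by (simp add: field_simps)
  qed
  finally show ?thesis
    unfolding 1 metric_prod_connection [OF G] by (simp only: sum.distrib)
qed

lemma partial_connection_const:
  assumes G: "C2_metric_on W G" "y \<in> W"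
  shows "(\<Sum>l\<in>UNIV. v $ l * partial l (\<lambda>z. connection G z w t $ i) y) = connection_deriv G y v w t $ i"
proof -
  note diff = christoffel_differentiable [OF G]
  have "partial l (\<lambda>z. connection G z w t $ i) y =
      (\<Sum>j\<in>UNIV. \<Sum>k\<in>UNIV. partial l (\<lambda>z. christoffel G z i j k) y * w $ j * t $ k)" for l
    by (simp add: connection_def partial_sum partial_mult diff)
  then have "(\<Sum>l\<in>UNIV. v $ l * partial l (\<lambda>z. connection G z w t $ i) y) =
      (\<Sum>l\<in>UNIV. \<Sum>j\<in>UNIV. \<Sum>k\<in>UNIV. partial l (\<lambda>z. christoffel G z i j k) y * v $ l * w $ j * t $ k)"
    by (simp add: sum_distrib_left mult_ac)
  also have "\<dots> = (\<Sum>j\<in>UNIV. \<Sum>k\<in>UNIV. \<Sum>l\<in>UNIV. partial l (\<lambda>z. christoffel G z i j k) y * v $ l * w $ j * t $ k)"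
    by (rule sum_rotate)
  finally show ?thesis
    by (simp add: connection_deriv_def sum_distrib_right)
qed

lemma cov_deriv_connection:
  "cov_deriv G X Y y = (\<chi> i. \<Sum>j\<in>UNIV. X y $ j * partial j (\<lambda>z. Y z $ i) y) + connection G y (X y) (Y y)"
  by (simp add: cov_deriv_def connection_def vec_eq_iff)

text \<open>For fields with constant components the Lie bracket vanishes and a first covariant derivative
  consists of Christoffel symbols only.\<close>

lemma curvature_at_connection:
  assumes G: "C2_metric_on W G" "y \<in> W"
  shows "curvature_at G y v w t = connection_deriv G y v w t - connection_deriv G y w v t
    + connection G y v (connection G y w t) - connection G y w (connection G y v t)"
proof -
  have const: "cov_deriv G X (\<lambda>_. t) = (\<lambda>y. connection G y (X y) t)" for X t
    by (simp add: cov_deriv_connection fun_eq_iff vec_eq_iff)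
  have second: "cov_deriv G (\<lambda>_. v) (\<lambda>y. connection G y w t) y =
      connection_deriv G y v w t + connection G y v (connection G y w t)" for v w
    by (simp add: cov_deriv_connection vec_eq_iff partial_connection_const [OF G])
  have "lie_bracket (\<lambda>_. v) (\<lambda>_. w) y = 0"
    by (simp add: lie_bracket_def vec_eq_iff)
  then show ?thesis
    by (simp add: curvature_at_def curvature_def const second)
qed

section \<open>Vector fields along a map\<close>

lemma tangent_basis_twice:
  "tangent_basis (tangent_basis Y b) a u $ i = partial a (partial b (\<lambda>v. Y v $ i)) u"
  by (simp add: tangent_basis_def)

text \<open>A map into a coordinate domain with a Riemannian metric. Two instances matter:
  the embedding of \<open>\<Sigma>\<close>, and the identity map of its coordinate domain with the induced metric.\<close>

locale metric_along_map =
  fixes W :: "(real^'m::finite) set" and G :: "real^'m \<Rightarrow> real^'m^'m"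
    and U :: "(real^'n::finite) set" and x :: "real^'n \<Rightarrow> real^'m"
  assumes metric: "C2_metric_on W G" and open_domain: "open U"
    and smooth_map: "smooth_on U x" and maps_to: "\<And>u. u \<in> U \<Longrightarrow> x u \<in> W"
begin

abbreviation frame :: "'n \<Rightarrow> real^'n \<Rightarrow> real^'m" where
  "frame a \<equiv> tangent_basis x a"

abbreviation covd :: "'n \<Rightarrow> (real^'n \<Rightarrow> real^'m) \<Rightarrow> real^'n \<Rightarrow> real^'m" where
  "covd a \<equiv> cov_deriv_along G x a"

abbreviation prod_at :: "real^'n \<Rightarrow> real^'m \<Rightarrow> real^'m \<Rightarrow> real" where
  "prod_at u \<equiv> metric_prod (G (x u))"

lemma prod_at_commute: "u \<in> U \<Longrightarrow> prod_at u v w = prod_at u w v"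
  by (metis metric_prod_commute C2_metric_onD(2) metric maps_to)

lemma map_differentiable: "u \<in> U \<Longrightarrow> x differentiable (at u)"
  by (rule smooth_on_differentiable [OF smooth_map])

lemma smooth_frame: "smooth_on U (\<lambda>u. frame a u $ i)"
  using smooth_on_partial [OF smooth_on_nth [OF smooth_map open_domain]]
  by (simp add: tangent_basis_def)

lemma smooth_partial_frame: "smooth_on U (\<lambda>u. tangent_basis (frame a) b u $ i)"
  using smooth_on_partial [OF smooth_frame [of a i], of b]
  by (simp add: tangent_basis_def [of "frame a"])

lemma differentiable_frame: "u \<in> U \<Longrightarrow> (\<lambda>v. frame a v $ i) differentiable (at u)"
  by (rule smooth_on_differentiable [OF smooth_frame])

lemma differentiable_along:
  "f differentiable (at (x u)) \<Longrightarrow> u \<in> U \<Longrightarrow> (\<lambda>v. f (x v)) differentiable (at u)"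
  using differentiable_chain_at [OF map_differentiable] by (simp add: o_def)

lemma partial_frame_commute:
  assumes "u \<in> U"
  shows "tangent_basis (frame b) a u = tangent_basis (frame a) b u"
  using partial_commute [OF smooth_on_nth [OF smooth_map open_domain] open_domain assms]
  by (simp add: vec_eq_iff tangent_basis_twice)

lemma partial_partial_frame_commute:
  assumes "u \<in> U"
  shows "tangent_basis (tangent_basis (frame c) b) a u = tangent_basis (tangent_basis (frame c) a) b u"
  using partial_commute [OF smooth_frame open_domain assms]
  by (simp add: vec_eq_iff tangent_basis_twice)

lemma covd_frame_commute:
  assumes "u \<in> U"
  shows "covd a (frame b) u = covd b (frame a) u"
  by (simp add: cov_deriv_along_connection partial_frame_commute [OF assms, of b a]
      connection_commute [OF metric maps_to [OF assms], of "frame a u"])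

lemma differentiable_prod_at:
  assumes "u \<in> U" "\<And>i. (\<lambda>v. Y v $ i) differentiable (at u)" "\<And>i. (\<lambda>v. Z v $ i) differentiable (at u)"
  shows "(\<lambda>v. prod_at v (Y v) (Z v)) differentiable (at u)"
  unfolding metric_prod_def
  by (intro differentiable_sum ballI finite differentiable_mult assms differentiable_along
      C2_metric_onD(5) [OF metric maps_to])

lemma differentiable_connection:
  assumes "u \<in> U" "\<And>i. (\<lambda>v. Y v $ i) differentiable (at u)" "\<And>i. (\<lambda>v. Z v $ i) differentiable (at u)"
  shows "(\<lambda>v. connection G (x v) (Y v) (Z v) $ i) differentiable (at u)"
  unfolding connection_def vec_lambda_beta
  by (intro differentiable_sum ballI finite differentiable_mult assms
      differentiable_along [OF christoffel_differentiable [OF metric maps_to]])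

lemma differentiable_covd_frame:
  assumes "u \<in> U"
  shows "(\<lambda>v. covd a (frame b) v $ i) differentiable (at u)"
  unfolding cov_deriv_along_connection vector_add_component
  by (intro differentiable_add smooth_on_differentiable [OF smooth_partial_frame]
      differentiable_connection differentiable_frame assms)

text \<open>The chain rule reduces compatibility with the metric to \<open>metric_prod_deriv\<close> at the image point.\<close>

lemma partial_prod_at:
  assumes u: "u \<in> U" and Y: "\<And>i. (\<lambda>v. Y v $ i) differentiable (at u)"
    and Z: "\<And>i. (\<lambda>v. Z v $ i) differentiable (at u)"
  shows "partial a (\<lambda>v. prod_at v (Y v) (Z v)) u =
    prod_at u (covd a Y u) (Z u) + prod_at u (Y u) (covd a Z u)"
proof -
  note G = C2_metric_onD(5) [OF metric maps_to [OF u]]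
  have "partial a (\<lambda>v. prod_at v (Y v) (Z v)) u =
      (\<Sum>i\<in>UNIV. \<Sum>j\<in>UNIV. partial a (\<lambda>v. G (x v) $ i $ j) u * Y u $ i * Z u $ j
        + G (x u) $ i $ j * tangent_basis Y a u $ i * Z u $ j
        + G (x u) $ i $ j * Y u $ i * tangent_basis Z a u $ j)"
    by (simp add: metric_prod_def partial_sum partial_mult differentiable_along [OF G u] Y Z
        tangent_basis_def algebra_simps)
  also have "\<dots> = metric_prod (\<chi> i j. \<Sum>l\<in>UNIV. partial l (\<lambda>z. G z $ i $ j) (x u) * frame a u $ l) (Y u) (Z u)
      + prod_at u (tangent_basis Y a u) (Z u) + prod_at u (Y u) (tangent_basis Z a u)"
    by (simp add: metric_prod_def partial_chain [OF G map_differentiable [OF u]] sum.distrib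
        tangent_basis_def)
  also have "\<dots> = prod_at u (covd a Y u) (Z u) + prod_at u (Y u) (covd a Z u)"
    by (simp add: metric_prod_deriv [OF metric maps_to [OF u]] cov_deriv_along_connection
        metric_prod_add_left metric_prod_add_right)
  finally show ?thesis .
qed

lemma tangent_basis_connection:
  assumes u: "u \<in> U" and Y: "\<And>i. (\<lambda>v. Y v $ i) differentiable (at u)"
    and Z: "\<And>i. (\<lambda>v. Z v $ i) differentiable (at u)"
  shows "tangent_basis (\<lambda>v. connection G (x v) (Y v) (Z v)) a u =
    connection_deriv G (x u) (frame a u) (Y u) (Z u)
    + connection G (x u) (tangent_basis Y a u) (Z u) + connection G (x u) (Y u) (tangent_basis Z a u)"
proof -
  note C = christoffel_differentiable [OF metric maps_to [OF u]]
  show ?thesis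
    by (simp add: vec_eq_iff tangent_basis_def connection_def connection_deriv_def partial_sum
        partial_mult differentiable_along [OF C u] Y Z partial_chain [OF C map_differentiable [OF u]]
        sum.distrib algebra_simps)
qed

lemma tangent_basis_add:
  assumes "\<And>i. (\<lambda>v. Y v $ i) differentiable (at u)" "\<And>i. (\<lambda>v. Z v $ i) differentiable (at u)"
  shows "tangent_basis (\<lambda>v. Y v + Z v) a u = tangent_basis Y a u + tangent_basis Z a u"
  by (simp add: vec_eq_iff tangent_basis_def partial_add assms)

text \<open>In the commutator the second partial derivatives of \<open>frame c\<close> cancel by Schwarz's theorem, and so
  do the terms with first derivatives.\<close>

lemma curvature_commutator:
  assumes u: "u \<in> U"
  shows "covd a (covd b (frame c)) u - covd b (covd a (frame c)) u =
    curvature_at G (x u) (frame a u) (frame b u) (frame c u)"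
proof -
  have second: "covd a (covd b (frame c)) u = tangent_basis (tangent_basis (frame c) b) a u
      + connection_deriv G (x u) (frame a u) (frame b u) (frame c u)
      + connection G (x u) (tangent_basis (frame b) a u) (frame c u)
      + connection G (x u) (frame b u) (tangent_basis (frame c) a u)
      + connection G (x u) (frame a u) (tangent_basis (frame c) b u)
      + connection G (x u) (frame a u) (connection G (x u) (frame b u) (frame c u))" for a b
    unfolding cov_deriv_along_connection [abs_def]
    by (simp add: tangent_basis_add tangent_basis_connection u differentiable_frame
        differentiable_connection smooth_on_differentiable [OF smooth_partial_frame]
        connection_add_right)
  show ?thesis
    unfolding second curvature_at_connection [OF metric maps_to [OF u]]
    using partial_partial_frame_commute [OF u, of c a b] partial_frame_commute [OF u, of b a]
    by simp
qed

text \<open>The three derivatives on the right are sums of two products each by compatibility with the metric;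
  four of the six cancel because \<open>covd a (frame b)\<close> is symmetric in \<open>a\<close> and \<open>b\<close>.\<close>

lemma koszul_frame:
  assumes u: "u \<in> U"
  shows "prod_at u (covd d (frame b) u) (frame a u) =
    (partial d (\<lambda>v. induced_metric G x v $ b $ a) u + partial b (\<lambda>v. induced_metric G x v $ d $ a) u
     - partial a (\<lambda>v. induced_metric G x v $ d $ b) u) / 2"
proof -
  have eq: "partial d (\<lambda>v. induced_metric G x v $ b $ a) u =
      prod_at u (covd d (frame b) u) (frame a u) + prod_at u (covd d (frame a) u) (frame b u)" for d b a
    by (simp add: induced_metric_def partial_prod_at u differentiable_frame
        prod_at_commute [OF u, of "frame b u"])
  show ?thesis
    unfolding eq covd_frame_commute [OF u, of b d] covd_frame_commute [OF u, of a d]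
      covd_frame_commute [OF u, of a b]
    by simp
qed

text \<open>Compatibility with the metric trades the outer derivative in \<open>covd c (covd d (frame b))\<close> for a
  derivative of an inner product that the induced metric determines.\<close>

lemma curvature_frame:
  assumes u: "u \<in> U"
  shows "prod_at u (curvature_at G (x u) (frame c u) (frame d u) (frame b u)) (frame a u) =
    partial c (\<lambda>v. prod_at v (covd d (frame b) v) (frame a v)) u
    - partial d (\<lambda>v. prod_at v (covd c (frame b) v) (frame a v)) u
    - prod_at u (covd d (frame b) u) (covd c (frame a) u)
    + prod_at u (covd c (frame b) u) (covd d (frame a) u)"
  by (simp add: partial_prod_at u differentiable_frame differentiable_covd_frame metric_prod_diff_left
      flip: curvature_commutator [OF u])

text \<open>Compatibility with the metric expresses the derivatives of the induced metric by inner products of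
  differentiable fields; hence they are differentiable again. Injectivity of the differential makes
  the induced metric definite.\<close>

lemma C2_induced_metric:
  assumes inj: "\<And>u. u \<in> U \<Longrightarrow> inj (frechet_derivative x (at u))"
  shows "C2_metric_on U (induced_metric G x)"
  unfolding C2_metric_on_def
proof (intro conjI ballI allI impI)
  show "open U"
    by (rule open_domain)
  fix u assume u: "u \<in> U"
  show "transpose (induced_metric G x u) = induced_metric G x u"
    by (simp add: vec_eq_iff transpose_def induced_metric_def prod_at_commute [OF u])
  show "(\<lambda>v. induced_metric G x v $ a $ b) differentiable (at u)" for a b
    unfolding induced_metric_def by (simp add: differentiable_prod_at u differentiable_frame)
  show "partial c (\<lambda>v. induced_metric G x v $ a $ b) differentiable (at u)" for a b c
  proof (rule differentiable_cong_open [OF _ open_domain u])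
    show "(\<lambda>v. prod_at v (covd c (frame a) v) (frame b v) + prod_at v (frame a v) (covd c (frame b) v))
        differentiable (at u)"
      by (intro differentiable_add differentiable_prod_at u differentiable_frame differentiable_covd_frame)
    show "prod_at v (covd c (frame a) v) (frame b v) + prod_at v (frame a v) (covd c (frame b) v) =
        partial c (\<lambda>v. induced_metric G x v $ a $ b) v" if "v \<in> U" for v
      by (simp add: induced_metric_def partial_prod_at that differentiable_frame)
  qed
  fix w :: "real^'n" assume "w \<noteq> 0"
  let ?D = "frechet_derivative x (at u)"
  have lin: "linear ?D"
    by (rule linear_frechet_derivative [OF map_differentiable [OF u]])
  have frame: "frame a u = ?D (axis a 1)" for a
  proof -
    have "((\<lambda>v. x v $ i) has_derivative (\<lambda>w. ?D w $ i)) (at u)" for i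
      using map_differentiable [OF u] unfolding frechet_derivative_works
      by (rule bounded_linear.has_derivative [OF bounded_linear_vec_nth])
    then have "partial a (\<lambda>v. x v $ i) u = ?D (axis a 1) $ i" for i
      by (rule partial_has_derivative)
    then show ?thesis
      by (simp add: vec_eq_iff tangent_basis_def)
  qed
  have "?D w = ?D (\<Sum>a\<in>UNIV. w $ a *\<^sub>R axis a 1)"
    using basis_expansion [of w] by (simp add: scalar_mult_eq_scaleR)
  then have Dw: "?D w = (\<Sum>a\<in>UNIV. w $ a *\<^sub>R frame a u)"
    by (simp add: linear_sum [OF lin] linear_cmul [OF lin] frame)
  have "?D w \<noteq> 0"
    using \<open>w \<noteq> 0\<close> inj [OF u] linear_injective_0 [OF lin] by blast
  then have "prod_at u (?D w) (?D w) > 0"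
    using metric maps_to [OF u] by (simp add: metric_prod_inner C2_metric_on_def)
  also have "prod_at u (?D w) (?D w) = (\<Sum>a\<in>UNIV. w $ a * prod_at u (frame a u) (?D w))"
    by (subst Dw) (simp add: metric_prod_sum_left metric_prod_scaleR_left)
  also have "\<dots> = (\<Sum>a\<in>UNIV. \<Sum>b\<in>UNIV. w $ a * w $ b * prod_at u (frame a u) (frame b u))"
    by (simp add: Dw metric_prod_sum_right metric_prod_scaleR_right sum_distrib_left mult.assoc)
  also have "\<dots> = metric_prod (induced_metric G x u) w w"
    unfolding metric_prod_def [of "induced_metric G x u"] by (simp add: induced_metric_def mult_ac)
  finally show "w \<bullet> (induced_metric G x u *v w) > 0"
    by (simp add: metric_prod_inner)
qed

end

section \<open>Decomposition into tangential and normal part\<close>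

lemma matrix_inv_symmetric:
  fixes A :: "real^'k::finite^'k"
  assumes A: "transpose A = A" "invertible A"
  shows "matrix_inv A $ i $ j = matrix_inv A $ j $ i"
proof -
  have "transpose (matrix_inv A) ** A = transpose (A ** matrix_inv A)"
    using A by (simp add: matrix_transpose_mul)
  then have "transpose (matrix_inv A) ** A ** matrix_inv A = matrix_inv A"
    by (simp add: matrix_inv_mult A)
  then have "transpose (matrix_inv A) = matrix_inv A"
    by (simp add: matrix_inv_mult A flip: matrix_mul_assoc)
  then have "transpose (matrix_inv A) $ i $ j = matrix_inv A $ i $ j"
    by simp
  then show ?thesis
    by (simp add: transpose_def)
qed

text \<open>A tangent vector is recovered from its inner products with the basis \<open>e\<close> through the inverse Gram
  matrix.\<close>

lemma matrix_inv_combination: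
  fixes e :: "'n::finite \<Rightarrow> real^'m::finite"
  assumes "invertible (\<chi> a b. metric_prod G (e a) (e b))"
  shows "metric_prod G (\<Sum>r\<in>UNIV. (s v* matrix_inv (\<chi> a b. metric_prod G (e a) (e b))) $ r *\<^sub>R e r) (e a) = s $ a"
proof -
  let ?g = "\<chi> a b. metric_prod G (e a) (e b)"
  have "metric_prod G (\<Sum>r\<in>UNIV. (s v* matrix_inv ?g) $ r *\<^sub>R e r) (e a) = ((s v* matrix_inv ?g) v* ?g) $ a"
    by (simp add: metric_prod_sum_left metric_prod_scaleR_left vector_matrix_mult_def mult.commute)
  also have "(s v* matrix_inv ?g) v* ?g = s"
    by (simp add: vector_matrix_mul_assoc matrix_inv_mult assms)
  finally show ?thesis .
qed

text \<open>Taking the inner products with all \<open>e a\<close> and all \<open>N A\<close> is a surjective linear map, hence an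
  injective one between spaces of the same dimension.\<close>

lemma orthogonal_to_frame_imp_zero:
  fixes G :: "real^'m::finite^'m" and e :: "'n::finite \<Rightarrow> real^'m" and N :: "'p::finite \<Rightarrow> real^'m"
  assumes dim: "CARD('m) = CARD('n) + CARD('p)"
    and inv: "invertible (\<chi> a b. metric_prod G (e a) (e b))"
    and sym: "transpose G = G"
    and NN: "\<And>A B. metric_prod G (N A) (N B) = (if A = B then 1 else 0)"
    and Ne: "\<And>A a. metric_prod G (N A) (e a) = 0"
    and Y: "\<And>a. metric_prod G Y (e a) = 0" "\<And>A. metric_prod G Y (N A) = 0"
  shows "Y = 0"
proof -
  define L :: "real^'m \<Rightarrow> (real^'n) \<times> (real^'p)"
    where "L = (\<lambda>Y. (\<chi> a. metric_prod G Y (e a), \<chi> A. metric_prod G Y (N A)))"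
  have lin: "linear L"
    by (rule linearI) (simp_all add: L_def vec_eq_iff metric_prod_add_left metric_prod_scaleR_left)
  have eN: "metric_prod G (e a) (N A) = 0" for a A
    using Ne metric_prod_commute [OF sym] by metis
  have "L ((\<Sum>r\<in>UNIV. (s v* matrix_inv (\<chi> a b. metric_prod G (e a) (e b))) $ r *\<^sub>R e r)
      + (\<Sum>A\<in>UNIV. t $ A *\<^sub>R N A)) = (s, t)" for s t
    using matrix_inv_combination [OF inv, of s]
    by (simp add: L_def vec_eq_iff metric_prod_add_left)
       (simp add: metric_prod_sum_left metric_prod_scaleR_left NN Ne eN if_distrib cong: if_cong)
  then have "(s, t) \<in> range L" for s t
    by (rule range_eqI [OF HOL.sym])
  then have "surj L"
    by auto
  then have "inj L"
    by (intro eucl.linear_surjective_imp_injective [OF lin]) (simp_all add: dim dim_UNIV)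
  moreover have "L Y = L 0"
    using Y by (simp add: L_def vec_eq_iff metric_prod_inner)
  ultimately show ?thesis
    by (simp add: inj_eq)
qed

text \<open>The difference of \<open>Y\<close> and its expansion in the \<open>e a\<close> and \<open>N A\<close> is orthogonal to all of them. The case
  of empty \<open>P\<close> is the tangent space of \<open>\<Sigma>\<close> with its own metric.\<close>

lemma metric_prod_frame_expansion:
  fixes G :: "real^'m::finite^'m" and e :: "'n::finite \<Rightarrow> real^'m" and N :: "'p::finite \<Rightarrow> real^'m"
  assumes inv: "invertible (\<chi> a b. metric_prod G (e a) (e b))"
    and sym: "transpose G = G"
    and NN: "\<And>A B. A \<in> P \<Longrightarrow> B \<in> P \<Longrightarrow> metric_prod G (N A) (N B) = (if A = B then 1 else 0)"
    and Ne: "\<And>A a. A \<in> P \<Longrightarrow> metric_prod G (N A) (e a) = 0"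
    and complete: "\<And>Y. (\<And>a. metric_prod G Y (e a) = 0) \<Longrightarrow>
        (\<And>A. A \<in> P \<Longrightarrow> metric_prod G Y (N A) = 0) \<Longrightarrow> Y = 0"
  shows "metric_prod G Y Z =
    (\<Sum>q\<in>UNIV. \<Sum>r\<in>UNIV. matrix_inv (\<chi> a b. metric_prod G (e a) (e b)) $ q $ r
       * metric_prod G Y (e q) * metric_prod G Z (e r))
    + (\<Sum>A\<in>P. metric_prod G Y (N A) * metric_prod G Z (N A))"
proof -
  let ?gi = "matrix_inv (\<chi> a b. metric_prod G (e a) (e b))"
  define t where "t = (\<chi> a. metric_prod G Y (e a)) v* ?gi"
  define T where "T = (\<Sum>r\<in>UNIV. t $ r *\<^sub>R e r)"
  define V where "V = (\<Sum>A\<in>P. metric_prod G Y (N A) *\<^sub>R N A)"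
  have eN: "metric_prod G (e a) (N A) = 0" if "A \<in> P" for a A
    using Ne [OF that] metric_prod_commute [OF sym] by metis
  have "metric_prod G T (e a) = metric_prod G Y (e a)" for a
    using matrix_inv_combination [OF inv, of "\<chi> a. metric_prod G Y (e a)"] by (simp add: T_def t_def)
  moreover have "metric_prod G V (e a) = 0" for a
    by (simp add: V_def metric_prod_sum_left metric_prod_scaleR_left Ne)
  moreover have "metric_prod G T (N A) = 0" if "A \<in> P" for A
    by (simp add: T_def metric_prod_sum_left metric_prod_scaleR_left eN that)
  moreover have "metric_prod G V (N A) = metric_prod G Y (N A)" if "A \<in> P" for A
  proof -
    have "metric_prod G V (N A) = (\<Sum>B\<in>P. metric_prod G Y (N B) * (if B = A then 1 else 0))"
      by (simp add: V_def metric_prod_sum_left metric_prod_scaleR_left NN that)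
    then show ?thesis
      using that by (simp add: if_distrib cong: if_cong)
  qed
  ultimately have "Y - T - V = 0"
    by (intro complete) (simp_all add: metric_prod_diff_left)
  then have "Y = T + V"
    by (simp add: algebra_simps)
  then have "metric_prod G Y Z = metric_prod G T Z + metric_prod G V Z"
    by (simp add: metric_prod_add_left)
  moreover have "metric_prod G V Z = (\<Sum>A\<in>P. metric_prod G Y (N A) * metric_prod G Z (N A))"
    by (simp add: V_def metric_prod_sum_left metric_prod_scaleR_left metric_prod_commute [OF sym, of Z])
  moreover
  have "metric_prod G T Z = (\<Sum>r\<in>UNIV. \<Sum>q\<in>UNIV. ?gi $ q $ r * metric_prod G Y (e q) * metric_prod G Z (e r))"
    by (simp add: T_def t_def metric_prod_sum_left metric_prod_scaleR_left metric_prod_commute [OF sym, of Z]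
        vector_matrix_mult_def sum_distrib_left sum_distrib_right mult_ac)
  then have "metric_prod G T Z = (\<Sum>q\<in>UNIV. \<Sum>r\<in>UNIV. ?gi $ q $ r * metric_prod G Y (e q) * metric_prod G Z (e r))"
    by (rule trans) (rule sum.swap)
  ultimately show ?thesis
    by simp
qed

section \<open>The Gauss equation\<close>

context metric_along_map
begin

lemma induced_metric_along_identity:
  assumes "\<And>u. u \<in> U \<Longrightarrow> inj (frechet_derivative x (at u))"
  shows "metric_along_map U (induced_metric G x) U (\<lambda>u. u)"
  by unfold_locales (auto intro: C2_induced_metric assms open_domain smooth_on_ident)

end

text \<open>On the coordinate domain of \<open>\<Sigma>\<close>, the identity map induces the given metric and its frame consists
  of the unit vectors; so the statements about maps become statements about the intrinsic geometry.\<close>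

lemma tangent_basis_ident: "tangent_basis (\<lambda>u. u) a u = axis a 1"
proof -
  have "partial a (\<lambda>v. v $ i) u = axis a 1 $ i" for i
    by (rule partial_has_derivative) (rule bounded_linear_imp_has_derivative [OF bounded_linear_vec_nth])
  then show ?thesis
    by (simp add: tangent_basis_def vec_eq_iff)
qed

lemma induced_metric_ident: "induced_metric G (\<lambda>u. u) = G"
  by (simp add: fun_eq_iff induced_metric_def tangent_basis_ident metric_prod_axis vec_eq_iff)

definition second_fundamental_form ::
  "(real^'m \<Rightarrow> real^'m^'m) \<Rightarrow> (real^'n \<Rightarrow> real^'m) \<Rightarrow> (real^'n \<Rightarrow> real^'m::finite) \<Rightarrow>
   real^'n::finite \<Rightarrow> real^'n^'n" where
  "second_fundamental_form h x N u =
     (\<chi> a b. metric_prod (h (x u)) (cov_deriv_along h x a (tangent_basis x b) u) (N u))"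

definition shape_operator ::
  "(real^'m \<Rightarrow> real^'m^'m) \<Rightarrow> (real^'n \<Rightarrow> real^'m) \<Rightarrow> (real^'n \<Rightarrow> real^'m::finite) \<Rightarrow>
   real^'n::finite \<Rightarrow> real^'n^'n" where
  "shape_operator h x N u =
     matrix_inv (induced_metric h x u) ** second_fundamental_form h x N u"

text \<open>An immersion with an orthonormal frame of its normal bundle, in local coordinates.\<close>

locale normal_frame = metric_along_map W G U x
  for W :: "(real^'m::finite) set" and G :: "real^'m \<Rightarrow> real^'m^'m"
    and U :: "(real^'n::finite) set" and x :: "real^'n \<Rightarrow> real^'m" +
  fixes N :: "'p::finite \<Rightarrow> real^'n \<Rightarrow> real^'m"
  assumes immersion: "\<And>u. u \<in> U \<Longrightarrow> inj (frechet_derivative x (at u))"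
    and codimension: "CARD('m) = CARD('n) + CARD('p)"
    and differentiable_normal: "\<And>A i u. u \<in> U \<Longrightarrow> (\<lambda>v. N A v $ i) differentiable (at u)"
    and orthonormal: "\<And>A B u. u \<in> U \<Longrightarrow> prod_at u (N A u) (N B u) = (if A = B then 1 else 0)"
    and normal: "\<And>A a u. u \<in> U \<Longrightarrow> prod_at u (N A u) (frame a u) = 0"
begin

abbreviation g :: "real^'n \<Rightarrow> real^'n^'n" where
  "g \<equiv> induced_metric G x"

lemmas C2_g = C2_induced_metric [OF immersion]

lemma g_inv_commute: "u \<in> U \<Longrightarrow> matrix_inv (g u) $ a $ b = matrix_inv (g u) $ b $ a"
  by (intro matrix_inv_symmetric C2_metric_onD [OF C2_g]) auto

abbreviation second_form :: "'p \<Rightarrow> real^'n \<Rightarrow> real^'n^'n" where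
  "second_form A u \<equiv> second_fundamental_form G x (N A) u"

abbreviation shape :: "'p \<Rightarrow> real^'n \<Rightarrow> real^'n^'n" where
  "shape A u \<equiv> shape_operator G x (N A) u"

text \<open>Differentiate the constant function \<open>gbar(N\<^sub>A, e\<^sub>b) = 0\<close>.\<close>

lemma weingarten:
  assumes u: "u \<in> U"
  shows "prod_at u (covd a (N A) u) (frame b u) = - second_form A u $ a $ b"
proof -
  have "0 = partial a (\<lambda>v. prod_at v (N A v) (frame b v)) u"
    using partial_cong_open [OF open_domain u, of "\<lambda>v. prod_at v (N A v) (frame b v)" "\<lambda>v. 0" a] normal
    by simp
  also have "\<dots> = prod_at u (covd a (N A) u) (frame b u) + prod_at u (N A u) (covd a (frame b) u)"
    by (rule partial_prod_at [OF u differentiable_normal [OF u] differentiable_frame [OF u]])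
  finally show ?thesis
    by (simp add: second_fundamental_form_def prod_at_commute [OF u, of "N A u"])
qed

text \<open>The frame and the normal vectors span the ambient tangent space because of the codimension.\<close>

lemma prod_at_expansion:
  assumes u: "u \<in> U"
  shows "prod_at u Y Z =
    (\<Sum>q\<in>UNIV. \<Sum>r\<in>UNIV. matrix_inv (g u) $ q $ r * prod_at u Y (frame q u) * prod_at u Z (frame r u))
    + (\<Sum>A\<in>UNIV. prod_at u Y (N A u) * prod_at u Z (N A u))"
proof -
  have g: "(\<chi> a b. prod_at u (frame a u) (frame b u)) = g u"
    by (simp add: induced_metric_def)
  have inv: "invertible (\<chi> a b. prod_at u (frame a u) (frame b u))"
    unfolding g by (rule C2_metric_onD(4) [OF C2_g u])
  note sym = C2_metric_onD(2) [OF metric maps_to [OF u]]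
  show ?thesis
    unfolding g [symmetric]
  proof (rule metric_prod_frame_expansion [OF inv sym])
    fix Y assume "\<And>a. prod_at u Y (frame a u) = 0" "\<And>A. A \<in> UNIV \<Longrightarrow> prod_at u Y (N A u) = 0"
    then show "Y = 0"
      by (intro orthogonal_to_frame_imp_zero [OF codimension inv sym orthonormal [OF u] normal [OF u]]) auto
  qed (use orthonormal [OF u] normal [OF u] in auto)
qed

lemma metric_prod_g_expansion:
  assumes u: "u \<in> U"
  shows "metric_prod (g u) Y Z = (\<Sum>q\<in>UNIV. \<Sum>r\<in>UNIV.
    matrix_inv (g u) $ q $ r * metric_prod (g u) Y (axis q 1) * metric_prod (g u) Z (axis r 1))"
proof -
  have id: "(\<chi> a b. metric_prod (g u) (axis a 1) (axis b 1)) = g u"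
    by (simp add: metric_prod_axis vec_eq_iff)
  have "Y = 0" if "\<And>a. metric_prod (g u) Y (axis a 1) = 0" for Y
  proof (rule ccontr)
    assume "Y \<noteq> 0"
    have "metric_prod (g u) Y Y = metric_prod (g u) Y (\<Sum>a\<in>UNIV. Y $ a *\<^sub>R axis a 1)"
      using basis_expansion [of Y] by (simp add: scalar_mult_eq_scaleR)
    also have "\<dots> = 0"
      by (simp add: metric_prod_sum_right metric_prod_scaleR_right that)
    finally have "metric_prod (g u) Y Y = 0" .
    moreover have "metric_prod (g u) Y Y > 0"
      using C2_g u \<open>Y \<noteq> 0\<close> by (simp add: C2_metric_on_def metric_prod_inner)
    ultimately show False
      by simp
  qed
  note zero = this
  have "metric_prod (g u) Y Z = (\<Sum>q\<in>UNIV. \<Sum>r\<in>UNIV. matrix_inv (g u) $ q $ r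
      * metric_prod (g u) Y (axis q 1) * metric_prod (g u) Z (axis r 1))
      + (\<Sum>A\<in>({} :: 'p set). metric_prod (g u) Y 0 * metric_prod (g u) Z 0)"
    using C2_metric_onD [OF C2_g u] zero
    by (intro metric_prod_frame_expansion [of "g u" "\<lambda>a. axis a 1" "{}" "\<lambda>A. 0", unfolded id]) auto
  then show ?thesis
    by simp
qed

text \<open>The formula \<open>curvature_frame\<close> for the immersion and for the identity map with the metric \<open>g\<close>. By the
  Koszul formula the tangential components of \<open>covd d (frame b)\<close> are those of the intrinsic covariant
  derivative.\<close>

theorem gauss_equation:
  assumes u: "u \<in> U"
  shows "metric_prod (g u) (curvature_at g u (axis c 1) (axis d 1) (axis b 1)) (axis a 1) =
    prod_at u (curvature_at G (x u) (frame c u) (frame d u) (frame b u)) (frame a u)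
    + (\<Sum>A\<in>UNIV. second_form A u $ d $ b * second_form A u $ c $ a
        - second_form A u $ c $ b * second_form A u $ d $ a)"
proof -
  interpret I: metric_along_map U g U "\<lambda>u. u"
    by (rule induced_metric_along_identity [OF immersion])
  have koszul: "prod_at v (covd d (frame b) v) (frame a v) =
      metric_prod (g v) (I.covd d (I.frame b) v) (I.frame a v)" if "v \<in> U" for v d b a
    by (simp add: koszul_frame [OF that] I.koszul_frame [OF that] induced_metric_ident)
  have partial_koszul: "partial c (\<lambda>v. prod_at v (covd d (frame b) v) (frame a v)) u =
      partial c (\<lambda>v. metric_prod (g v) (I.covd d (I.frame b) v) (I.frame a v)) u" for c d b a
    by (rule partial_cong_open [OF open_domain u koszul])
  have tangential: "metric_prod (g u) (I.covd d (I.frame b) u) (I.covd c (I.frame a) u) =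
      (\<Sum>q\<in>UNIV. \<Sum>r\<in>UNIV. matrix_inv (g u) $ q $ r
        * prod_at u (covd d (frame b) u) (frame q u) * prod_at u (covd c (frame a) u) (frame r u))" for c d b a
    by (subst metric_prod_g_expansion [OF u]) (simp add: koszul [OF u] tangent_basis_ident)
  have split: "prod_at u (covd d (frame b) u) (covd c (frame a) u) =
      metric_prod (g u) (I.covd d (I.frame b) u) (I.covd c (I.frame a) u)
      + (\<Sum>A\<in>UNIV. second_form A u $ d $ b * second_form A u $ c $ a)" for c d b a
    unfolding tangential prod_at_expansion [OF u, of "covd d (frame b) u" "covd c (frame a) u"]
    by (simp add: second_fundamental_form_def)
  show ?thesis
    using curvature_frame [OF u, of c d b a] I.curvature_frame [OF u, of c d b a]
    by (simp add: partial_koszul split tangent_basis_ident sum_subtractf)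
qed

definition ambient_ricci :: "real^'n \<Rightarrow> real^'n^'n" where
  "ambient_ricci u = (\<chi> q b. \<Sum>a\<in>UNIV. \<Sum>c\<in>UNIV. \<Sum>d\<in>UNIV.
     matrix_inv (g u) $ a $ c * matrix_inv (g u) $ q $ d *
     prod_at u (curvature_at G (x u) (frame c u) (frame d u) (frame b u)) (frame a u))"

text \<open>Contraction of the Gauss equation: the product \<open>K\<^sub>A(d,b) K\<^sub>A(c,a)\<close> separates into a trace and a shape
  operator, while \<open>K\<^sub>A(c,b) K\<^sub>A(d,a)\<close> composes two shape operators.\<close>

theorem ricci_map_gauss:
  assumes u: "u \<in> U"
  shows "ricci_map g u = ambient_ricci u
    + (\<Sum>A\<in>UNIV. trace (shape A u) *\<^sub>R shape A u - shape A u ** shape A u)"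
proof -
  let ?gi = "matrix_inv (g u)" and ?K = "\<lambda>A. second_form A u"
  have trace_part: "(\<Sum>a\<in>UNIV. \<Sum>c\<in>UNIV. \<Sum>d\<in>UNIV. ?gi $ a $ c * ?gi $ q $ d * (?K A $ d $ b * ?K A $ c $ a)) =
      trace (shape A u) * shape A u $ q $ b" for A q b
    unfolding trace_def shape_operator_def matrix_matrix_mult_def vec_lambda_beta sum_distrib_right
    unfolding sum_distrib_left by (simp add: mult_ac)
  have square_part: "(\<Sum>a\<in>UNIV. \<Sum>c\<in>UNIV. \<Sum>d\<in>UNIV. ?gi $ a $ c * ?gi $ q $ d * (?K A $ c $ b * ?K A $ d $ a)) =
      (shape A u ** shape A u) $ q $ b" for A q b
  proof -
    have "(shape A u ** shape A u) $ q $ b =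
        (\<Sum>a\<in>UNIV. \<Sum>d\<in>UNIV. \<Sum>c\<in>UNIV. ?gi $ a $ c * ?gi $ q $ d * (?K A $ c $ b * ?K A $ d $ a))"
      unfolding shape_operator_def matrix_matrix_mult_def vec_lambda_beta sum_product
      by (simp add: mult_ac)
    also have "\<dots> = (\<Sum>a\<in>UNIV. \<Sum>c\<in>UNIV. \<Sum>d\<in>UNIV.
        ?gi $ a $ c * ?gi $ q $ d * (?K A $ c $ b * ?K A $ d $ a))"
      by (rule sum.cong [OF refl], rule sum.swap)
    finally show ?thesis ..
  qed
  have "ricci_map g u $ q $ b = (ambient_ricci u
      + (\<Sum>A\<in>UNIV. trace (shape A u) *\<^sub>R shape A u - shape A u ** shape A u)) $ q $ b" for q b
  proof -
    have "ricci_map g u $ q $ b = ambient_ricci u $ q $ b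
        + (\<Sum>a\<in>UNIV. \<Sum>c\<in>UNIV. \<Sum>d\<in>UNIV. \<Sum>A\<in>UNIV.
            ?gi $ a $ c * ?gi $ q $ d * (?K A $ d $ b * ?K A $ c $ a)
            - ?gi $ a $ c * ?gi $ q $ d * (?K A $ c $ b * ?K A $ d $ a))"
      by (simp add: ricci_map_def ambient_ricci_def gauss_equation [OF u] distrib_left sum.distrib
          sum_distrib_left right_diff_distrib)
    also have "(\<Sum>a\<in>UNIV. \<Sum>c\<in>UNIV. \<Sum>d\<in>UNIV. \<Sum>A\<in>UNIV.
            ?gi $ a $ c * ?gi $ q $ d * (?K A $ d $ b * ?K A $ c $ a)
            - ?gi $ a $ c * ?gi $ q $ d * (?K A $ c $ b * ?K A $ d $ a))
        = (\<Sum>a\<in>UNIV. \<Sum>A\<in>UNIV. \<Sum>c\<in>UNIV. \<Sum>d\<in>UNIV.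
            ?gi $ a $ c * ?gi $ q $ d * (?K A $ d $ b * ?K A $ c $ a)
            - ?gi $ a $ c * ?gi $ q $ d * (?K A $ c $ b * ?K A $ d $ a))"
      by (rule sum.cong [OF refl], rule sum_rotate [symmetric])
    also have "\<dots> = (\<Sum>A\<in>UNIV. \<Sum>a\<in>UNIV. \<Sum>c\<in>UNIV. \<Sum>d\<in>UNIV.
            ?gi $ a $ c * ?gi $ q $ d * (?K A $ d $ b * ?K A $ c $ a)
            - ?gi $ a $ c * ?gi $ q $ d * (?K A $ c $ b * ?K A $ d $ a))"
      by (rule sum.swap)
    also have "\<dots> = (\<Sum>A\<in>UNIV. trace (shape A u) * shape A u $ q $ b - (shape A u ** shape A u) $ q $ b)"
      unfolding sum_subtractf trace_part square_part ..
    finally show ?thesis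
      by simp
  qed
  then show ?thesis
    by (simp add: vec_eq_iff)
qed

end

section \<open>The maps built from the brackets\<close>

lemma sum_product_weighted:
  fixes \<alpha> :: "'a \<Rightarrow> real"
  shows "(\<Sum>I\<in>S. \<Sum>J\<in>T. (\<Sum>a\<in>A. \<alpha> a * p a I) * (\<Sum>b\<in>B. \<beta> b * q b J) * H I J) =
    (\<Sum>a\<in>A. \<Sum>b\<in>B. \<alpha> a * \<beta> b * (\<Sum>I\<in>S. \<Sum>J\<in>T. p a I * q b J * H I J))"
proof -
  have "(\<Sum>I\<in>S. \<Sum>J\<in>T. (\<Sum>a\<in>A. \<alpha> a * p a I) * (\<Sum>b\<in>B. \<beta> b * q b J) * H I J) =
      (\<Sum>I\<in>S. \<Sum>J\<in>T. \<Sum>a\<in>A. \<Sum>b\<in>B. \<alpha> a * \<beta> b * (p a I * q b J * H I J))"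
    unfolding sum_product unfolding sum_distrib_right by (simp add: mult_ac)
  also have "\<dots> = (\<Sum>a\<in>A. \<Sum>I\<in>S. \<Sum>J\<in>T. \<Sum>b\<in>B. \<alpha> a * \<beta> b * (p a I * q b J * H I J))"
    by (rule sum_rotate [symmetric])
  also have "\<dots> = (\<Sum>a\<in>A. \<Sum>b\<in>B. \<Sum>I\<in>S. \<Sum>J\<in>T. \<alpha> a * \<beta> b * (p a I * q b J * H I J))"
    by (rule sum.cong [OF refl], rule sum_rotate [symmetric])
  finally show ?thesis
    by (simp add: sum_distrib_left)
qed

text \<open>The common factor of \<open>\<P>\<close> and \<open>\<T>\<close>: up to sign, the minor of the Jacobian matrix of \<open>x\<close>
  formed by the rows \<open>I\<close> and all columns except \<open>a\<close>, written out by the Leibniz formula.\<close>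

definition frame_minor ::
  "(real^'n::_ \<Rightarrow> real^'m::finite) \<Rightarrow> real^'n::{finite,linorder} \<Rightarrow> 'n \<Rightarrow> 'm list \<Rightarrow> real" where
  "frame_minor x u a I = (\<Sum>as\<in>multi_indices (CARD('n) - 1).
     levi_civita (a # as) * (\<Prod>k<CARD('n) - 1. tangent_basis x (as ! k) u $ (I ! k)))"

lemma P_tensor_frame_minor:
  fixes x :: "real^'n::{finite,linorder} \<Rightarrow> real^'m::finite" and u :: "real^'n::_"
  assumes I: "I \<in> multi_indices (CARD('n) - 1)"
  shows "P_tensor \<rho> x u i I = 1 / (sqrt (fact (CARD('n) - 1)) * \<rho> u) *
    (\<Sum>a\<in>UNIV. tangent_basis x a u $ i * frame_minor x u a I)"
proof -
  obtain r where r: "CARD('n) = Suc r"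
    using not0_implies_Suc [of "CARD('n)"] by auto
  have len: "length I = r"
    using I by (simp add: multi_indices_def r)
  have "(\<Prod>k<r. partial (as ! k) (map (\<lambda>j v. x v $ j) I ! k) u)
      = (\<Prod>k<r. tangent_basis x (as ! k) u $ (I ! k))" for as
    by (rule prod.cong) (simp_all add: len tangent_basis_def)
  then show ?thesis
    unfolding P_tensor_def nbracket_def frame_minor_def r
    by (simp add: sum_multi_indices_Suc prod.lessThan_Suc_shift sum_distrib_left tangent_basis_def mult_ac
        del: prod.lessThan_Suc)
qed

text \<open>The minus sign is what remains of the factor \<open>(-1)\<^sup>n\<close> in \<open>\<T>\<close> when the free index is moved to the
  front of the Levi-Civita symbol.\<close>

lemma T_tensor_frame_minor:
  fixes x :: "real^'n::{finite,linorder} \<Rightarrow> real^'m::finite" and u :: "real^'n::_"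
  shows "T_tensor h \<rho> x N u J j = - 1 / (sqrt (fact (CARD('n) - 1)) * \<rho> u) *
    (\<Sum>b\<in>UNIV. cov_deriv_along h x b N u $ j * frame_minor x u b J)"
proof -
  obtain r where r: "CARD('n) = Suc r"
    using not0_implies_Suc [of "CARD('n)"] by auto
  have rotate: "(-1) ^ Suc r * levi_civita (bs @ [b]) = - levi_civita (b # bs)"
    if "bs \<in> multi_indices r" for bs and b :: 'n
    using that levi_civita_rotate [of "[]" bs b "[]"]
    by (simp add: multi_indices_def flip: power_add mult.assoc mult_2)
  let ?s = "sqrt (fact r)" and ?e = "\<lambda>bs. \<Prod>k<r. tangent_basis x (bs ! k) u $ (J ! k)"
  have "T_tensor h \<rho> x N u J j = (\<Sum>bs\<in>multi_indices r. \<Sum>b\<in>UNIV.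
      1 / (?s * \<rho> u) * (((-1) ^ Suc r * levi_civita (bs @ [b])) * (cov_deriv_along h x b N u $ j * ?e bs)))"
    by (simp add: T_tensor_def r sum_distrib_left tangent_basis_def mult_ac)
  also have "\<dots> = (\<Sum>bs\<in>multi_indices r. \<Sum>b\<in>UNIV.
      1 / (?s * \<rho> u) * (- levi_civita (b # bs) * (cov_deriv_along h x b N u $ j * ?e bs)))"
    by (intro sum.cong refl) (simp only: rotate)
  also have "\<dots> = (\<Sum>b\<in>UNIV. \<Sum>bs\<in>multi_indices r.
      1 / (?s * \<rho> u) * (- levi_civita (b # bs) * (cov_deriv_along h x b N u $ j * ?e bs)))"
    by (rule sum.swap)
  finally show ?thesis
    by (simp add: frame_minor_def r sum_distrib_left mult_ac)
qed

text \<open>A Cauchy-Binet type identity: contraction with the ambient metric in each slot turns the derivatives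
  of \<open>x\<close> into entries of the induced metric, and what remains is a cofactor.\<close>

lemma sum_frame_minor:
  fixes x :: "real^'n::{finite,linorder} \<Rightarrow> real^'m::finite" and u :: "real^'n::_"
  assumes "invertible (induced_metric h x u)"
  shows "(\<Sum>I\<in>multi_indices (CARD('n) - 1). \<Sum>J\<in>multi_indices (CARD('n) - 1).
      frame_minor x u a I * frame_minor x u b J * (\<Prod>k<CARD('n) - 1. h (x u) $ (I ! k) $ (J ! k)))
    = fact (CARD('n) - 1) * det (induced_metric h x u) * matrix_inv (induced_metric h x u) $ b $ a"
proof -
  let ?r = "CARD('n) - 1" and ?e = "\<lambda>a. tangent_basis x a u"
  have "(\<Sum>I\<in>multi_indices ?r. \<Sum>J\<in>multi_indices ?r. (\<Prod>k<?r. ?e (as ! k) $ (I ! k)) *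
        (\<Prod>k<?r. ?e (bs ! k) $ (J ! k)) * (\<Prod>k<?r. h (x u) $ (I ! k) $ (J ! k)))
      = (\<Prod>k<?r. induced_metric h x u $ (as ! k) $ (bs ! k))" for as bs
    unfolding prod.distrib [symmetric]
    by (subst sum_multi_indices_prod [of "\<lambda>k i j. ?e (as ! k) $ i * ?e (bs ! k) $ j * h (x u) $ i $ j"])
       (simp add: induced_metric_def metric_prod_def mult_ac)
  then show ?thesis
    using levi_civita_cofactor [OF assms, of a b] unfolding frame_minor_def sum_product_weighted by simp
qed

lemma B_tensor_frame:
  fixes x :: "real^'n::{finite,linorder} \<Rightarrow> real^'m::finite" and u :: "real^'n::_"
  assumes inv: "invertible (induced_metric h x u)"
  shows "B_tensor h \<rho> x N u $ i $ k = - (det (induced_metric h x u) / (\<rho> u)\<^sup>2) *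
    (\<Sum>a\<in>UNIV. \<Sum>b\<in>UNIV. matrix_inv (induced_metric h x u) $ b $ a *
       tangent_basis x a u $ i * cov_deriv_along h x b N u $ k)"
proof -
  let ?r = "CARD('n) - 1"
  let ?c = "sqrt (fact ?r) * \<rho> u"
  have "B_tensor h \<rho> x N u $ i $ k = - 1 / ?c\<^sup>2 * (\<Sum>I\<in>multi_indices ?r. \<Sum>J\<in>multi_indices ?r.
      (\<Sum>a\<in>UNIV. tangent_basis x a u $ i * frame_minor x u a I) *
      (\<Sum>b\<in>UNIV. cov_deriv_along h x b N u $ k * frame_minor x u b J) *
      (\<Prod>k<?r. h (x u) $ (I ! k) $ (J ! k)))"
    by (simp add: B_tensor_def P_tensor_frame_minor T_tensor_frame_minor sum_distrib_left
        power2_eq_square mult_ac)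
  also have "\<dots> = - 1 / ?c\<^sup>2 * (\<Sum>a\<in>UNIV. \<Sum>b\<in>UNIV.
      tangent_basis x a u $ i * cov_deriv_along h x b N u $ k *
      (fact ?r * det (induced_metric h x u) * matrix_inv (induced_metric h x u) $ b $ a))"
    unfolding sum_product_weighted sum_frame_minor [OF inv] ..
  also have "?c\<^sup>2 = fact ?r * (\<rho> u)\<^sup>2"
    by (simp add: power_mult_distrib)
  finally show ?thesis
    by (simp add: sum_distrib_left mult_ac)
qed

lemma B_map_mult_vector:
  fixes x :: "real^'n::{finite,linorder} \<Rightarrow> real^'m::finite" and u :: "real^'n::_"
  assumes inv: "invertible (induced_metric h x u)"
  shows "B_map h \<rho> x N u *v Y = - (det (induced_metric h x u) / (\<rho> u)\<^sup>2) *\<^sub>R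
    (\<Sum>a\<in>UNIV. \<Sum>b\<in>UNIV. (matrix_inv (induced_metric h x u) $ b $ a *
       metric_prod (h (x u)) (cov_deriv_along h x b N u) Y) *\<^sub>R tangent_basis x a u)"
proof -
  let ?gi = "matrix_inv (induced_metric h x u)" and ?e = "\<lambda>a. tangent_basis x a u"
    and ?n = "\<lambda>b. cov_deriv_along h x b N u" and ?Z = "h (x u) *v Y"
  let ?c = "- (det (induced_metric h x u) / (\<rho> u)\<^sup>2)"
  have "(B_map h \<rho> x N u *v Y) $ i = ?c * (\<Sum>a\<in>UNIV. \<Sum>b\<in>UNIV. ?gi $ b $ a * metric_prod (h (x u)) (?n b) Y * ?e a $ i)" for i
  proof -
    have "(B_map h \<rho> x N u *v Y) $ i = (\<Sum>k\<in>UNIV. B_tensor h \<rho> x N u $ i $ k * ?Z $ k)"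
      unfolding B_map_def matrix_vector_mul_assoc [symmetric]
      by (simp only: matrix_vector_mult_def vec_lambda_beta)
    also have "\<dots> = ?c * (\<Sum>k\<in>UNIV. \<Sum>a\<in>UNIV. \<Sum>b\<in>UNIV. ?gi $ b $ a * ?e a $ i * (?n b $ k * ?Z $ k))"
      unfolding B_tensor_frame [OF inv]
      by (simp add: sum_distrib_left sum_distrib_right mult_ac)
    also have "(\<Sum>k\<in>UNIV. \<Sum>a\<in>UNIV. \<Sum>b\<in>UNIV. ?gi $ b $ a * ?e a $ i * (?n b $ k * ?Z $ k))
        = (\<Sum>a\<in>UNIV. \<Sum>b\<in>UNIV. \<Sum>k\<in>UNIV. ?gi $ b $ a * ?e a $ i * (?n b $ k * ?Z $ k))"
      by (rule sum_rotate)
    also have "\<dots> = (\<Sum>a\<in>UNIV. \<Sum>b\<in>UNIV. ?gi $ b $ a * metric_prod (h (x u)) (?n b) Y * ?e a $ i)"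
      by (simp add: metric_prod_inner inner_vec_def sum_distrib_left mult_ac)
    finally show ?thesis .
  qed
  then show ?thesis
    by (simp add: vec_eq_iff)
qed

text \<open>The trace is taken over the ambient tangent space, in the standard basis of its coordinates; summing
  over that basis reassembles the tangent vector \<open>tangent_basis x a u\<close>.\<close>

lemma trace_B_map:
  fixes x :: "real^'n::{finite,linorder} \<Rightarrow> real^'m::finite" and u :: "real^'n::_"
  assumes inv: "invertible (induced_metric h x u)"
  shows "trace (B_map h \<rho> x N u) = - (det (induced_metric h x u) / (\<rho> u)\<^sup>2) *
    (\<Sum>a\<in>UNIV. \<Sum>b\<in>UNIV. matrix_inv (induced_metric h x u) $ b $ a *
       metric_prod (h (x u)) (cov_deriv_along h x b N u) (tangent_basis x a u))"
proof -
  let ?gi = "matrix_inv (induced_metric h x u)" and ?e = "\<lambda>a. tangent_basis x a u"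
    and ?n = "\<lambda>b. cov_deriv_along h x b N u" and ?c = "- (det (induced_metric h x u) / (\<rho> u)\<^sup>2)"
  have "B_map h \<rho> x N u $ i $ i = (B_map h \<rho> x N u *v axis i 1) $ i" for i
    by (simp add: matrix_vector_mul_component inner_axis)
  then have "trace (B_map h \<rho> x N u) = ?c * (\<Sum>i\<in>UNIV. \<Sum>a\<in>UNIV. \<Sum>b\<in>UNIV.
      ?gi $ b $ a * metric_prod (h (x u)) (?n b) (?e a $ i *\<^sub>R axis i 1))"
    by (simp add: trace_def B_map_mult_vector [OF inv] metric_prod_scaleR_right sum_distrib_left sum_negf mult_ac)
  also have "(\<Sum>i\<in>UNIV. \<Sum>a\<in>UNIV. \<Sum>b\<in>UNIV.
      ?gi $ b $ a * metric_prod (h (x u)) (?n b) (?e a $ i *\<^sub>R axis i 1))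
    = (\<Sum>a\<in>UNIV. \<Sum>b\<in>UNIV. \<Sum>i\<in>UNIV.
      ?gi $ b $ a * metric_prod (h (x u)) (?n b) (?e a $ i *\<^sub>R axis i 1))"
    by (rule sum_rotate)
  also have "\<dots> = (\<Sum>a\<in>UNIV. \<Sum>b\<in>UNIV. ?gi $ b $ a *
      metric_prod (h (x u)) (?n b) (\<Sum>i\<in>UNIV. ?e a $ i *\<^sub>R axis i 1))"
    by (simp only: metric_prod_sum_right sum_distrib_left)
  also have "\<dots> = (\<Sum>a\<in>UNIV. \<Sum>b\<in>UNIV. ?gi $ b $ a * metric_prod (h (x u)) (?n b) (?e a))"
    using basis_expansion [where 'a = real and 'n = 'm] by (simp add: scalar_mult_eq_scaleR)
  finally show ?thesis .
qed

text \<open>Only the tangential part of the derivatives of \<open>N A\<close> matters, and the Weingarten equation cancels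
  the sign of \<open>B_tensor_frame\<close>.\<close>

lemma B_map_shape_operator:
  fixes x :: "real^'n::{finite,linorder} \<Rightarrow> real^'m::finite" and u w :: "real^'n::_"
  assumes "normal_frame W h U x N" and u: "u \<in> U"
  shows "B_map h \<rho> x (N A) u *v (\<Sum>b\<in>UNIV. w $ b *\<^sub>R tangent_basis x b u) =
      (det (induced_metric h x u) / (\<rho> u)\<^sup>2) *\<^sub>R
        (\<Sum>a\<in>UNIV. (shape_operator h x (N A) u *v w) $ a *\<^sub>R tangent_basis x a u)"
    and "trace (B_map h \<rho> x (N A) u) =
      det (induced_metric h x u) / (\<rho> u)\<^sup>2 * trace (shape_operator h x (N A) u)"
proof -
  interpret normal_frame W h U x N by fact
  let ?gi = "matrix_inv (g u)" and ?K = "second_form A u" and ?F = "\<Sum>b\<in>UNIV. w $ b *\<^sub>R frame b u"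
  let ?k = "det (g u) / (\<rho> u)\<^sup>2"
  have inv: "invertible (g u)"
    by (rule C2_metric_onD(4) [OF C2_g u])
  have "prod_at u (covd b (N A) u) ?F = - (?K *v w) $ b" for b
    by (simp add: metric_prod_sum_right metric_prod_scaleR_right weingarten [OF u] sum_negf
        matrix_vector_mult_def mult.commute)
  then have "B_map h \<rho> x (N A) u *v ?F =
      ?k *\<^sub>R (\<Sum>a\<in>UNIV. \<Sum>b\<in>UNIV. (?gi $ a $ b * (?K *v w) $ b) *\<^sub>R frame a u)"
    by (simp add: B_map_mult_vector [OF inv] sum_negf g_inv_commute [OF u])
  moreover have "(\<Sum>b\<in>UNIV. (?gi $ a $ b * (?K *v w) $ b) *\<^sub>R frame a u) = (shape A u *v w) $ a *\<^sub>R frame a u" for a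
    unfolding shape_operator_def matrix_vector_mul_assoc [symmetric]
    by (simp add: matrix_vector_mult_def [of ?gi] scaleR_sum_left)
  ultimately show "B_map h \<rho> x (N A) u *v ?F = ?k *\<^sub>R (\<Sum>a\<in>UNIV. (shape A u *v w) $ a *\<^sub>R frame a u)"
    by simp
  have "trace (B_map h \<rho> x (N A) u) = ?k * (\<Sum>a\<in>UNIV. \<Sum>b\<in>UNIV. ?gi $ b $ a * ?K $ b $ a)"
    by (simp add: trace_B_map [OF inv] weingarten [OF u] sum_negf)
  also have "(\<Sum>a\<in>UNIV. \<Sum>b\<in>UNIV. ?gi $ b $ a * ?K $ b $ a) = trace (shape A u)"
    by (simp add: trace_def shape_operator_def matrix_matrix_mult_def g_inv_commute [OF u])
  finally show "trace (B_map h \<rho> x (N A) u) = ?k * trace (shape A u)" .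
qed

section \<open>Ricci curvature of a submanifold\<close>

lemma is_chart_coordinates:
  assumes "is_chart M c"
  shows "open (snd c ` fst c)" "inj_on (snd c) (fst c)"
proof -
  show "open (snd c ` fst c)"
    using assms by (simp add: is_chart_def)
  have "fst c \<subseteq> topspace M"
    using assms openin_subset by (auto simp: is_chart_def)
  then show "inj_on (snd c) (fst c)"
    using assms by (simp add: is_chart_def homeomorphic_eq_everything_map Int_absorb1)
qed

lemma coord_change_in_range:
  assumes "inj_on (snd c) (fst c)" "y \<in> overlap c c'"
  shows "coord_change c c' y \<in> snd c' ` fst c'"
  using assms by (auto simp: overlap_def coord_change_def)

lemma riemannian_metric_C2:
  assumes "riemannian_metric \<A> gbar" "c \<in> \<A>" "open (snd c ` fst c)"
  shows "C2_metric_on (snd c ` fst c) (gbar c)"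
proof -
  let ?W = "snd c ` fst c"
  have "smooth_on ?W (\<lambda>z. gbar c z $ i $ j)" for i j
    using assms by (intro smooth_on_nth) (simp_all add: riemannian_metric_def)
  then show ?thesis
    using assms smooth_on_differentiable smooth_on_partial
    unfolding C2_metric_on_def riemannian_metric_def by (metis (no_types, lifting))
qed

theorem theorem3p6:
  fixes M :: "'a topology"
    and \<A> :: "('a, 'm::finite) chart set"
    and gbar :: "('a, 'm) chart \<Rightarrow> real^'m \<Rightarrow> real^'m^'m"
    and \<Sigma> :: "'a set"
    and \<B> :: "('a, 'n::{finite,linorder}) chart set"
    and cM :: "('a, 'm) chart" and cS :: "('a, 'n) chart"
    and h :: "real^'m \<Rightarrow> real^'m^'m" and x :: "real^'n::_ \<Rightarrow> real^'m"
    and U :: "(real^'n::_) set"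
    and \<rho> :: "real^'n::_ \<Rightarrow> real"
    and N :: "'p::finite \<Rightarrow> real^'n::_ \<Rightarrow> real^'m"
    and u X :: "real^'n::_"
  assumes dim_n: "CARD('n) \<ge> 2"
    and dim_m: "CARD('m) = CARD('n) + CARD('p)"
    and M: "smooth_manifold M \<A>"
    and gbar: "riemannian_metric \<A> gbar"
    and \<Sigma>: "embedded_submanifold M \<A> \<Sigma> \<B>"
    and cM: "cM \<in> \<A>" and h: "h = gbar cM"
    and cS: "cS \<in> \<B>" and x: "x = coord_change cS cM"
    and U: "open U" "U \<subseteq> overlap cS cM"
    and \<rho>: "\<And>v. v \<in> U \<Longrightarrow> \<rho> v \<noteq> 0"
    and N_smooth: "\<And>A. smooth_on U (N A)"
    and N_orthonormal: "\<And>A B v. v \<in> U \<Longrightarrow>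
          metric_prod (h (x v)) (N A v) (N B v) = (if A = B then 1 else 0)"
    and N_normal: "\<And>A a v. v \<in> U \<Longrightarrow>
          metric_prod (h (x v)) (N A v) (tangent_basis x a v) = 0"
    and u: "u \<in> U"
  shows "(\<Sum>q\<in>UNIV. (ricci_map (induced_metric h x) u *v X) $ q *\<^sub>R tangent_basis x q u) =
     (\<Sum>q\<in>UNIV. \<Sum>d\<in>UNIV. \<Sum>a\<in>UNIV. \<Sum>c\<in>UNIV. \<Sum>b\<in>UNIV.
        (matrix_inv (induced_metric h x u) $ q $ d * matrix_inv (induced_metric h x u) $ a $ c *
         metric_prod (h (x u))
           (curvature_at h (x u) (tangent_basis x c u) (tangent_basis x d u) (tangent_basis x b u))
           (tangent_basis x a u) * X $ b) *\<^sub>R tangent_basis x q u)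
     + (1 / density_ratio h \<rho> x u ^ 4) *\<^sub>R
       (\<Sum>A\<in>UNIV. let BA = B_map h \<rho> x (N A) u; XM = (\<Sum>b\<in>UNIV. X $ b *\<^sub>R tangent_basis x b u)
          in trace BA *\<^sub>R (BA *v XM) - BA *v (BA *v XM))"
proof -
  let ?W = "snd cM ` fst cM"
  have charts: "is_chart M cM" "is_chart (subtopology M \<Sigma>) cS"
    using M \<Sigma> cM cS by (simp_all add: smooth_manifold_def embedded_submanifold_def)
  have "smooth_on (overlap cS cM) x"
    using \<Sigma> cM cS by (simp add: embedded_submanifold_def x)
  then have smooth_x: "smooth_on U x"
    using U(2) by (rule smooth_on_subset)
  have immersion: "inj (frechet_derivative x (at v))" if "v \<in> U" for v
  proof -
    have "v \<in> overlap cS cM"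
      using U(2) that by blast
    then show ?thesis
      using \<Sigma> cM cS by (simp add: embedded_submanifold_def x)
  qed
  have metric: "C2_metric_on ?W h"
    unfolding h by (rule riemannian_metric_C2 [OF gbar cM is_chart_coordinates(1) [OF charts(1)]])
  have "(\<lambda>v. N A v $ i) differentiable (at v)" if "v \<in> U" for A i v
    using smooth_on_differentiable [OF smooth_on_nth [OF N_smooth U(1)] that] .
  moreover have "x v \<in> ?W" if "v \<in> U" for v
    unfolding x using U(2) that
    by (intro coord_change_in_range is_chart_coordinates(2) [OF charts(2)]) auto
  ultimately interpret normal_frame ?W h U x N
    using metric U smooth_x immersion dim_m N_orthonormal N_normal by unfold_locales auto
  define k where "k = det (g u) / (\<rho> u)\<^sup>2"
  \<comment> \<open>The vector in the ambient tangent space with tangential components \<open>w\<close>.\<close>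
  define F where "F w = (\<Sum>a\<in>UNIV. w $ a *\<^sub>R frame a u)" for w :: "real^'n::_"
  have F: "F (v + w) = F v + F w" "F (v - w) = F v - F w" "F (r *\<^sub>R v) = r *\<^sub>R F v"
    "F (\<Sum>A\<in>UNIV. f A) = (\<Sum>A\<in>UNIV. F (f A))" for v w r and f :: "'p \<Rightarrow> real^'n::_"
    by (simp_all add: F_def scaleR_add_left sum.distrib scaleR_left_diff_distrib sum_subtractf
        scaleR_sum_right scaleR_sum_left sum.swap [of _ "UNIV :: 'p set" "UNIV :: 'n set"])
  have "k \<noteq> 0"
    using C2_metric_onD(4) [OF C2_g u] \<rho> [OF u] by (simp add: k_def invertible_det_nz)
  \<comment> \<open>The square root extends to negative numbers as an odd function; the fourth power of \<open>sqrt d\<close> is \<open>d\<^sup>2\<close> for either sign of \<open>d\<close>.\<close>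
  have "sqrt (det (g u)) ^ 4 = (sqrt (det (g u)) * sqrt (det (g u)))\<^sup>2"
    by (simp add: power2_eq_square power4_eq_xxxx mult.assoc)
  then have density: "density_ratio h \<rho> x u ^ 4 = k\<^sup>2"
    by (simp add: density_ratio_def k_def power_divide)
  have B: "B_map h \<rho> x (N A) u *v F w = k *\<^sub>R F (shape A u *v w)"
    "trace (B_map h \<rho> x (N A) u) = k * trace (shape A u)" for A w
    using B_map_shape_operator [OF normal_frame_axioms u] by (simp_all add: F_def k_def)
  have ambient: "F (ambient_ricci u *v X) =
      (\<Sum>q\<in>UNIV. \<Sum>d\<in>UNIV. \<Sum>a\<in>UNIV. \<Sum>c\<in>UNIV. \<Sum>b\<in>UNIV.
        (matrix_inv (g u) $ q $ d * matrix_inv (g u) $ a $ c *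
         prod_at u (curvature_at h (x u) (frame c u) (frame d u) (frame b u)) (frame a u) * X $ b) *\<^sub>R frame q u)"
  proof -
    have "(ambient_ricci u *v X) $ q = (\<Sum>d\<in>UNIV. \<Sum>a\<in>UNIV. \<Sum>c\<in>UNIV. \<Sum>b\<in>UNIV.
        matrix_inv (g u) $ q $ d * matrix_inv (g u) $ a $ c *
        prod_at u (curvature_at h (x u) (frame c u) (frame d u) (frame b u)) (frame a u) * X $ b)" (is "_ = ?R") for q
    proof -
      let ?f = "\<lambda>d a c b. matrix_inv (g u) $ q $ d * matrix_inv (g u) $ a $ c *
        prod_at u (curvature_at h (x u) (frame c u) (frame d u) (frame b u)) (frame a u) * X $ b"
      have "(ambient_ricci u *v X) $ q = (\<Sum>b\<in>UNIV. \<Sum>a\<in>UNIV. \<Sum>c\<in>UNIV. \<Sum>d\<in>UNIV. ?f d a c b)"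
        unfolding ambient_ricci_def matrix_vector_mult_def vec_lambda_beta sum_distrib_right
        by (simp add: mult_ac)
      also have "\<dots> = (\<Sum>a\<in>UNIV. \<Sum>b\<in>UNIV. \<Sum>c\<in>UNIV. \<Sum>d\<in>UNIV. ?f d a c b)"
        by (rule sum.swap)
      also have "\<dots> = (\<Sum>a\<in>UNIV. \<Sum>c\<in>UNIV. \<Sum>d\<in>UNIV. \<Sum>b\<in>UNIV. ?f d a c b)"
        by (rule sum.cong [OF refl], rule sum_rotate)
      also have "\<dots> = (\<Sum>d\<in>UNIV. \<Sum>a\<in>UNIV. \<Sum>c\<in>UNIV. \<Sum>b\<in>UNIV. ?f d a c b)"
        by (rule sum_rotate [symmetric])
      finally show ?thesis .
    qed
    then show ?thesis
      by (simp add: F_def scaleR_sum_left)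
  qed
  have "F (ricci_map g u *v X) = F (ambient_ricci u *v X)
      + (\<Sum>A\<in>UNIV. trace (shape A u) *\<^sub>R F (shape A u *v X) - F (shape A u *v (shape A u *v X)))"
  proof -
    have "(\<Sum>A\<in>UNIV. S A) *v X = (\<Sum>A\<in>UNIV. S A *v X)" for S :: "'p \<Rightarrow> (real^'n::_)^'n::_"
      by (simp add: vec_eq_iff matrix_vector_mult_def sum_distrib_right
          sum.swap [of _ "UNIV :: 'p set" "UNIV :: 'n set"])
    then show ?thesis
      by (simp add: ricci_map_gauss [OF u] matrix_vector_mult_add_rdistrib
          matrix_vector_mult_diff_rdistrib scaleR_matrix_vector_assoc [symmetric]
          matrix_vector_mul_assoc [symmetric] F)
  qed
  moreover have "(1 / k\<^sup>2) *\<^sub>R (\<Sum>A\<in>UNIV. (k * trace (shape A u)) *\<^sub>R k *\<^sub>R F (shape A u *v X)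
        - k *\<^sub>R k *\<^sub>R F (shape A u *v (shape A u *v X)))
      = (\<Sum>A\<in>UNIV. trace (shape A u) *\<^sub>R F (shape A u *v X) - F (shape A u *v (shape A u *v X)))"
    using \<open>k \<noteq> 0\<close>
    by (simp add: scaleR_sum_right scaleR_diff_right power2_eq_square)
  ultimately show ?thesis
    unfolding ambient density Let_def F_def [symmetric] B
    by (simp add: matrix_vector_mult_scaleR B)
qed

end
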